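(* Let $\Gamma$ be a countably infinite (discrete) group acting continuously on a compact metrizable space $X$. If the naive topological entropy $h^{\rm nv}(\Gamma\curvearrowright X)$ is positive, then the action $\Gamma\curvearrowright X$ is Li-Yorke chaotic.
   Context: Naive topological entropy: for a finite open cover $\mathcal U$ of $X$, $N(\mathcal U)$ is the minimal cardinality of subcovers of $\mathcal U$. For covers $\mathcal U,\mathcal V$, $\mathcal U\vee\mathcal V=\{U\cap V: U\in\mathcal U, V\in\mathcal V\}$. For a nonempty finite $F\subseteq\Gamma$, $\mathcal U^F=\bigvee_{s\in F}s^{-1}\mathcal U$. Set $h^{\rm nv}(\Gamma,\mathcal U)=\inf_F\frac{1}{|F|}\log N(\mathcal U^F)$, with $F$ ranging over nonempty finite subsets of $\Gamma$, and $h^{\rm nv}(\Gamma\curvearrowright X)=\sup_{\mathcal U}h^{\rm nv}(\Gamma,\mathcal U)$, with $\mathcal U$ ranging over finite open covers of $X$. Li-Yorke chaos: the action $\Gamma\curvearrowright X$ is Li-Yorke chaotic if there is an uncountable set $Y\subseteq X$ such that for any distinct $x,y\in Y$ one has $\limsup_{\Gamma\ni s\to\infty}\rho(sx,sy)>0$ and $\liminf_{\Gamma\ni s\to\infty}\rho(sx,sy)=0$, where $\rho$ is any given compatible metric on $X$. Here $s\to\infty$ means that $s$ eventually leaves every finite subset of $\Gamma$. *)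

theory Defs
  imports "HOL-Analysis.Analysis" "HOL-Algebra.Group_Action"
begin

text \<open>
  The library locale \<^locale>\<open>group_action\<close> asks each \<open>\<phi> s\<close> to be an element of the group of
  extensional bijections of the underlying set; the value of \<open>\<phi> s\<close> outside the space is
  therefore a mere convention. Since \<open>G\<close> is discrete, a continuous action is an action by
  continuous maps.
\<close>

definition continuous_action ::
    "('g, 'm) monoid_scheme \<Rightarrow> 'x topology \<Rightarrow> ('g \<Rightarrow> 'x \<Rightarrow> 'x) \<Rightarrow> bool" where
  "continuous_action G X \<phi> \<longleftrightarrow>
     group_action G (topspace X) \<phi> \<and> (\<forall>s\<in>carrier G. continuous_map X X (\<phi> s))"

definition finite_open_cover :: "'x topology \<Rightarrow> 'x set set \<Rightarrow> bool" where
  "finite_open_cover X \<U> \<longleftrightarrow> finite \<U> \<and> (\<forall>U\<in>\<U>. openin X U) \<and> \<Union>\<U> = topspace X"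

definition min_subcover_card :: "'x topology \<Rightarrow> 'x set set \<Rightarrow> nat" where
  "min_subcover_card X \<U> = (LEAST n. \<exists>\<V>. \<V> \<subseteq> \<U> \<and> finite \<V> \<and> \<Union>\<V> = topspace X \<and> card \<V> = n)"

definition cover_join :: "'x set set \<Rightarrow> 'x set set \<Rightarrow> 'x set set" where
  "cover_join \<U> \<V> = {U \<inter> V | U V. U \<in> \<U> \<and> V \<in> \<V>}"

text \<open>
  The join of a family of covers over a nonempty index set. The two lemmas below show that
  for finite index sets it is the iteration of the binary join.
\<close>

definition Cover_join :: "'i set \<Rightarrow> ('i \<Rightarrow> 'x set set) \<Rightarrow> 'x set set" where
  "Cover_join F \<U> = {\<Inter>i\<in>F. U i | U. \<forall>i\<in>F. U i \<in> \<U> i}"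

lemma Cover_join_singleton: "Cover_join {i} \<U> = \<U> i"
  by (auto simp: Cover_join_def)

lemma Cover_join_insert:
  assumes "i \<notin> F"
  shows "Cover_join (insert i F) \<U> = cover_join (\<U> i) (Cover_join F \<U>)"
proof
  show "Cover_join (insert i F) \<U> \<subseteq> cover_join (\<U> i) (Cover_join F \<U>)"
    by (auto simp: Cover_join_def cover_join_def)
  show "cover_join (\<U> i) (Cover_join F \<U>) \<subseteq> Cover_join (insert i F) \<U>"
  proof
    fix A assume "A \<in> cover_join (\<U> i) (Cover_join F \<U>)"
    then obtain W U where WU: "W \<in> \<U> i" "\<forall>j\<in>F. U j \<in> \<U> j" "A = W \<inter> (\<Inter>j\<in>F. U j)"
      by (auto simp: Cover_join_def cover_join_def)
    have "(\<Inter>j\<in>F. (U(i := W)) j) = (\<Inter>j\<in>F. U j)"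
      by (rule INF_cong) (use assms in auto)
    then have "A = (\<Inter>j\<in>insert i F. (U(i := W)) j)"
      unfolding INF_insert WU(3) by (simp only: fun_upd_same)
    moreover have "\<forall>j\<in>insert i F. (U(i := W)) j \<in> \<U> j"
      using WU by auto
    ultimately show "A \<in> Cover_join (insert i F) \<U>"
      unfolding Cover_join_def by blast
  qed
qed

definition translate_cover ::
    "'x topology \<Rightarrow> ('g \<Rightarrow> 'x \<Rightarrow> 'x) \<Rightarrow> 'g \<Rightarrow> 'x set set \<Rightarrow> 'x set set" where
  "translate_cover X \<phi> s \<U> = (\<lambda>U. {x \<in> topspace X. \<phi> s x \<in> U}) ` \<U>"

definition cover_power ::
    "'x topology \<Rightarrow> ('g \<Rightarrow> 'x \<Rightarrow> 'x) \<Rightarrow> 'g set \<Rightarrow> 'x set set \<Rightarrow> 'x set set" where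
  "cover_power X \<phi> F \<U> = Cover_join F (\<lambda>s. translate_cover X \<phi> s \<U>)"

text \<open>
  Entropy takes values in \<^typ>\<open>ereal\<close>, as the supremum may be infinite. For nonempty \<open>X\<close> every
  minimal subcover has at least one element; for empty \<open>X\<close> the convention \<open>ln 0 = 0\<close> makes the
  entropy zero.
\<close>

definition naive_entropy_cover ::
    "('g, 'm) monoid_scheme \<Rightarrow> 'x topology \<Rightarrow> ('g \<Rightarrow> 'x \<Rightarrow> 'x) \<Rightarrow> 'x set set \<Rightarrow> ereal" where
  "naive_entropy_cover G X \<phi> \<U> =
     (INF F \<in> {F. F \<subseteq> carrier G \<and> finite F \<and> F \<noteq> {}}.
        ereal (ln (real (min_subcover_card X (cover_power X \<phi> F \<U>))) / real (card F)))"

definition naive_entropy ::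
    "('g, 'm) monoid_scheme \<Rightarrow> 'x topology \<Rightarrow> ('g \<Rightarrow> 'x \<Rightarrow> 'x) \<Rightarrow> ereal" where
  "naive_entropy G X \<phi> = (SUP \<U> \<in> {\<U>. finite_open_cover X \<U>}. naive_entropy_cover G X \<phi> \<U>)"

definition compatible_metric :: "'x topology \<Rightarrow> ('x \<Rightarrow> 'x \<Rightarrow> real) \<Rightarrow> bool" where
  "compatible_metric X \<rho> \<longleftrightarrow>
     Metric_space (topspace X) \<rho> \<and> Metric_space.mtopology (topspace X) \<rho> = X"

text \<open>The filter of \<open>s \<rightarrow> \<infinity>\<close> in \<open>G\<close>: complements in \<open>G\<close> of finite subsets of \<open>G\<close>.\<close>

definition at_infinity_in :: "('g, 'm) monoid_scheme \<Rightarrow> 'g filter" where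
  "at_infinity_in G = inf cofinite (principal (carrier G))"

lemma eventually_at_infinity_in:
  "eventually P (at_infinity_in G) \<longleftrightarrow>
     (\<exists>F. finite F \<and> F \<subseteq> carrier G \<and> (\<forall>s\<in>carrier G - F. P s))"
proof
  assume "eventually P (at_infinity_in G)"
  then have "finite {s \<in> carrier G. \<not> P s}"
    by (simp add: at_infinity_in_def eventually_inf_principal eventually_cofinite)
  then show "\<exists>F. finite F \<and> F \<subseteq> carrier G \<and> (\<forall>s\<in>carrier G - F. P s)"
    by (intro exI[of _ "{s \<in> carrier G. \<not> P s}"]) auto
next
  assume "\<exists>F. finite F \<and> F \<subseteq> carrier G \<and> (\<forall>s\<in>carrier G - F. P s)"
  then obtain F where F: "finite F" "\<forall>s\<in>carrier G - F. P s"
    by blast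
  have "finite {s. \<not> (s \<in> carrier G \<longrightarrow> P s)}"
    by (rule finite_subset[OF _ F(1)]) (use F(2) in auto)
  then show "eventually P (at_infinity_in G)"
    by (simp add: at_infinity_in_def eventually_inf_principal eventually_cofinite)
qed

text \<open>
  For compact metrizable \<open>X\<close> the condition on a pair \<open>x, y\<close> does not depend on the compatible
  metric, so the uncountable set is chosen once for all of them.
\<close>

definition li_yorke_chaotic ::
    "('g, 'm) monoid_scheme \<Rightarrow> 'x topology \<Rightarrow> ('g \<Rightarrow> 'x \<Rightarrow> 'x) \<Rightarrow> bool" where
  "li_yorke_chaotic G X \<phi> \<longleftrightarrow>
     (\<exists>Y \<subseteq> topspace X. uncountable Y \<and>
        (\<forall>\<rho>. compatible_metric X \<rho> \<longrightarrow>
          (\<forall>x\<in>Y. \<forall>y\<in>Y. x \<noteq> y \<longrightarrow>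
             Limsup (at_infinity_in G) (\<lambda>s. ereal (\<rho> (\<phi> s x) (\<phi> s y))) > 0 \<and>
             Liminf (at_infinity_in G) (\<lambda>s. ereal (\<rho> (\<phi> s x) (\<phi> s y))) = 0)))"

end

theory Submission
  imports Defs
begin

text \<open>
  For a cover with positive entropy, a halving argument turns the lower bound on subcovers of
  \<open>\<U>\<^sup>F\<close> into a set \<open>J \<subseteq> F\<close> of proportional size that is independent for pairs of separated closed
  sets, where the pair used at \<open>s \<in> J\<close> may depend on \<open>s\<close>: for a non-amenable group one cannot
  pass to a single pair, so all densities are stated for finite families (colours).

  Positive density of a family of tuples survives two operations. By a Sauer--Shelah type count,
  the sets in the tuples may be cut into small pieces. And since many translates \<open>e t\<close> of some
  \<open>t\<close> lie in \<open>J\<close>, tuples \<open>C\<close>, \<open>C'\<close> of the family can be joined to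
  \<open>C v \<inter> h\<inverse> (C' w)\<close> with \<open>h\<close> outside any given finite set. Joining with a small constant set
  produces a time at which all points are close, and joining with two separated sets produces a
  time at which points with different labels are far apart. Iterating along binary words, and
  choosing the colours coherently by Koenig's lemma, gives a Cantor scheme of closed sets whose
  branches, thinned out so that distinct labels differ infinitely often, form the scrambled set.
\<close>

section \<open>Shattered coordinates\<close>

lemma sum_power_card_Pow:
  fixes x :: "'b::comm_semiring_1"
  assumes "finite Z"
  shows "(\<Sum>J\<in>Pow Z. x ^ card J) = (1 + x) ^ card Z"
  using prod_add[OF assms, of "\<lambda>_. x" "\<lambda>_. 1"] assms
  by (simp add: add.commute)

text \<open>Chernoff-type bound: give each \<open>J\<close> the weight \<open>x ^ card J\<close>.
  All subsets of \<open>Z\<close> together weigh at most \<open>exp (x * card Z)\<close>. If every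
  member had fewer than \<open>q * card Z\<close> elements, each would weigh at least
  \<open>exp (- c / 3 * card Z)\<close>, and the family would weigh too much because
  \<open>2 * c / 3 > x\<close>.\<close>

lemma large_member_of_large_family:
  fixes c :: real
  assumes "c > 0"
  obtains q :: real where "q > 0"
    and "\<And>(Z::'z set) \<J>. finite Z \<Longrightarrow> Z \<noteq> {} \<Longrightarrow> \<J> \<subseteq> Pow Z \<Longrightarrow> exp (c * card Z) \<le> card \<J> \<Longrightarrow>
           \<exists>J\<in>\<J>. q * card Z \<le> card J"
proof -
  define x where "x = min (1/2) (c/3)"
  have x: "0 < x" "x < 1" "x \<le> c/3" using assms by (auto simp: x_def)
  \<comment> \<open>Solves \<open>x powr q = exp (- c / 3)\<close>.\<close>
  define q where "q = c / (3 * - ln x)"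
  have lnx: "- ln x > 0" using x by simp
  have "q > 0" unfolding q_def using lnx assms by (intro divide_pos_pos mult_pos_pos) auto
  have qln: "q * ln x = - c/3" using lnx by (simp add: q_def field_simps)
  have "\<exists>J\<in>\<J>. q * card Z \<le> card J"
    if Z: "finite Z" "Z \<noteq> {}" and J: "\<J> \<subseteq> Pow Z" and le: "exp (c * card Z) \<le> card \<J>"
    for Z :: "'z set" and \<J>
  proof (rule ccontr)
    assume "\<not> ?thesis"
    then have small: "card J < q * card Z" if "J \<in> \<J>" for J using that by force
    have N: "card Z > 0" using Z by (simp add: card_gt_0_iff)
    have "exp (c * card Z) * exp (- c / 3 * card Z) \<le> card \<J> * exp (- c / 3 * card Z)"
      using le by (intro mult_right_mono) auto
    also have "\<dots> = (\<Sum>J\<in>\<J>. exp (- c / 3 * card Z))" by simp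
    also have "\<dots> \<le> (\<Sum>J\<in>\<J>. x ^ card J)"
    proof (rule sum_mono)
      fix J assume "J \<in> \<J>"
      then have "ln x * (q * card Z) \<le> ln x * card J"
        using small x by (intro mult_left_mono_neg) (auto intro: less_imp_le)
      then have "exp (- c / 3 * card Z) \<le> exp (card J * ln x)"
        using arg_cong[OF qln, of "\<lambda>u. u * card Z"] by (simp add: mult_ac)
      also have "\<dots> = x ^ card J" using x by (simp add: exp_of_nat_mult)
      finally show "exp (- c / 3 * card Z) \<le> x ^ card J" by blast
    qed
    also have "\<dots> \<le> (\<Sum>J\<in>Pow Z. x ^ card J)"
      using J Z x by (intro sum_mono2) auto
    also have "\<dots> = (1 + x) ^ card Z" by (rule sum_power_card_Pow[OF Z(1)])
    also have "\<dots> \<le> exp x ^ card Z" using x exp_ge_add_one_self[of x] by (intro power_mono) auto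
    also have "\<dots> = exp (card Z * x)" by (simp add: exp_of_nat_mult)
    finally have "exp (c * card Z + - c / 3 * card Z) \<le> exp (card Z * x)" by (simp only: exp_add)
    then have "c * card Z + - c / 3 * card Z \<le> card Z * x" by (simp only: exp_le_cancel_iff)
    then have "card Z * (2 * c / 3) \<le> card Z * x" by (simp add: field_simps)
    then have "2 * c / 3 \<le> x" using N by simp
    then show False using x assms by simp
  qed
  then show ?thesis by (rule that[OF \<open>q > 0\<close>])
qed

text \<open>The sets \<open>P z False\<close> and \<open>P z True\<close> need not cover, so a point
  may have no value at \<open>z\<close>. The empty set is shattered exactly when \<open>S\<close> is
  nonempty.\<close>

definition shattered :: "'z set \<Rightarrow> ('z \<Rightarrow> bool \<Rightarrow> 'x set) \<Rightarrow> 'x set \<Rightarrow> 'z set set" where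
  "shattered Z P S = {J. J \<subseteq> Z \<and> (\<forall>\<omega>. \<exists>x\<in>S. \<forall>z\<in>J. x \<in> P z (\<omega> z))}"

lemma finite_shattered: "finite Z \<Longrightarrow> finite (shattered Z P S)"
  by (rule finite_subset[of _ "Pow Z"]) (auto simp: shattered_def)

text \<open>A set shattered by either half is shattered by \<open>S\<close>; one shattered by both
  halves stays shattered after adding \<open>z\<close>, since the label at \<open>z\<close> chooses
  the half. The two kinds differ by containing \<open>z\<close> or not, so inclusion-exclusion gives
  the count.\<close>

lemma shattered_split:
  assumes "finite Z" "z \<notin> Z"
  shows "card (shattered Z P {x\<in>S. x \<in> P z False}) + card (shattered Z P {x\<in>S. x \<in> P z True})
           \<le> card (shattered (insert z Z) P S)"
proof -
  let ?A = "\<lambda>b. shattered Z P {x\<in>S. x \<in> P z b}"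
  have fin: "finite (?A b)" for b by (rule finite_shattered[OF assms(1)])
  have notin: "z \<notin> J" if "J \<in> ?A b" for J b using that assms(2) by (auto simp: shattered_def)
  have "card (?A False) + card (?A True) = card (?A False \<union> ?A True) + card (?A False \<inter> ?A True)"
    using fin by (rule card_Un_Int) fact
  also have "card (?A False \<inter> ?A True) = card (insert z ` (?A False \<inter> ?A True))"
    by (rule card_image[symmetric]) (use notin in \<open>auto simp: inj_on_def insert_ident\<close>)
  also have "card (?A False \<union> ?A True) + \<dots> = card ((?A False \<union> ?A True) \<union> insert z ` (?A False \<inter> ?A True))"
    by (rule card_Un_disjoint[symmetric]) (use fin notin in auto)
  also have "\<dots> \<le> card (shattered (insert z Z) P S)"
  proof (rule card_mono)
    show "finite (shattered (insert z Z) P S)" using assms by (intro finite_shattered) auto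
    have "insert z J \<in> shattered (insert z Z) P S" if "J \<in> ?A False" "J \<in> ?A True" for J
      unfolding shattered_def
    proof (intro CollectI conjI allI)
      show "insert z J \<subseteq> insert z Z" using that by (auto simp: shattered_def)
      fix \<omega> :: "'a \<Rightarrow> bool"
      have "J \<in> ?A (\<omega> z)" using that by (cases "\<omega> z") auto
      then show "\<exists>x\<in>S. \<forall>z\<in>insert z J. x \<in> P z (\<omega> z)"
        by (force simp: shattered_def)
    qed
    moreover have "J \<in> shattered (insert z Z) P S" if "J \<in> ?A b" for J b
      using that unfolding shattered_def by fast
    ultimately show "?A False \<union> ?A True \<union> insert z ` (?A False \<inter> ?A True) \<subseteq> shattered (insert z Z) P S"
      by auto
  qed
  finally show ?thesis .
qed

text \<open>
  Predict at each coordinate the value whose restriction shatters more sets. Every wrong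
  prediction halves the number of shattered sets, so a point is described by at most \<open>M\<close>
  mistakes, and \<open>(1 + y) ^ n / y ^ M\<close> bounds the number of mistake patterns.
\<close>

lemma halving_cover:
  fixes y :: real
  assumes "finite Z" and disj: "\<And>z. z \<in> Z \<Longrightarrow> P z False \<inter> P z True = {}"
    and y: "0 < y" "y \<le> 1" and "card (shattered Z P S) < 2 ^ Suc M"
  shows "\<exists>T::('z \<Rightarrow> bool) set. finite T \<and> card T * y ^ M \<le> (1 + y) ^ card Z \<and>
           (\<forall>x\<in>S. \<exists>t\<in>T. \<forall>z\<in>Z. x \<notin> P z (\<not> t z))"
  using assms(1,2,5)
proof (induction Z arbitrary: S M rule: finite_induct)
  case empty
  show ?case
    by (rule exI[of _ "{\<lambda>_. False}"]) (use y in \<open>auto simp: power_le_one\<close>)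
next
  case (insert z Z)
  define A where "A b = {x\<in>S. x \<in> P z b}" for b
  have split: "card (shattered Z P (A False)) + card (shattered Z P (A True)) \<le> card (shattered (insert z Z) P S)"
    unfolding A_def by (rule shattered_split) fact+
  have "card (shattered Z P (A False)) < 2 ^ M \<or> card (shattered Z P (A True)) < 2 ^ M"
    using split insert.prems(2) by auto
  \<comment> \<open>The prediction at \<open>z\<close> is \<open>\<not> b\<close>; a point of
    \<open>P z b\<close> uses up one of the \<open>M\<close> mistakes.\<close>
  then obtain b where b: "card (shattered Z P (A b)) < 2 ^ M" by blast
  have "card (shattered Z P S) \<le> card (shattered (insert z Z) P S)"
    by (rule card_mono) (use insert.hyps in \<open>auto intro!: finite_shattered simp: shattered_def\<close>)
  then obtain T2 where T2: "finite T2" "card T2 * y ^ M \<le> (1 + y) ^ card Z"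
      "\<forall>x\<in>S. \<exists>t\<in>T2. \<forall>z\<in>Z. x \<notin> P z (\<not> t z)"
    using insert.IH[of S M] insert.prems by auto
  have dz: "x \<notin> P z (\<not> b)" if "x \<in> P z b" for x
    using insert.prems(1)[of z] that by (cases b) auto
  have imT2: "\<exists>t\<in>(\<lambda>t. t(z := \<not> b)) ` T2. \<forall>z'\<in>insert z Z. x \<notin> P z' (\<not> t z')"
    if x: "x \<in> S" "x \<notin> P z b" for x
  proof -
    from T2(3) x obtain t where "t \<in> T2" "\<forall>z\<in>Z. x \<notin> P z (\<not> t z)" by blast
    then show ?thesis using x(2) \<open>z \<notin> Z\<close> by (intro bexI[of _ "t(z := \<not> b)"]) auto
  qed
  have cT2: "card ((\<lambda>t. t(z := \<not> b)) ` T2) * y ^ M \<le> (1 + y) ^ card Z"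
    by (rule order_trans[OF mult_right_mono T2(2)]) (use T2(1) y in \<open>auto intro: card_image_le\<close>)
  show ?case
  proof (cases M)
    case 0
    \<comment> \<open>No mistake is left: \<open>A b\<close> shatters not even the empty set, so it
      has no point.\<close>
    then have "shattered Z P (A b) = {}" using b insert.hyps by (simp add: finite_shattered)
    then have "{} \<notin> shattered Z P (A b)" by simp
    then have "A b = {}" by (auto simp: shattered_def)
    then have "x \<notin> P z b" if "x \<in> S" for x using that by (auto simp: A_def)
    moreover have "(1 + y) ^ card Z \<le> (1 + y) ^ card (insert z Z)"
      using insert.hyps y by (intro power_increasing) auto
    ultimately show ?thesis
      using imT2 cT2 T2(1) by (intro exI[of _ "(\<lambda>t. t(z := \<not> b)) ` T2"]) auto
  next
    case (Suc M')
    then obtain T1 where T1: "finite T1" "card T1 * y ^ M' \<le> (1 + y) ^ card Z"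
        "\<forall>x\<in>A b. \<exists>t\<in>T1. \<forall>z\<in>Z. x \<notin> P z (\<not> t z)"
      using insert.IH[of "A b" M'] insert.prems(1) b by auto
    \<comment> \<open>\<open>T1\<close> serves the points with a wrong prediction and has one
      mistake less, hence a factor \<open>y\<close>; \<open>T2\<close> serves the others with the
      same \<open>M\<close>. The bounds add up to \<open>(y + 1) * (1 + y) ^ card Z\<close>.\<close>
    let ?T1 = "(\<lambda>t. t(z := b)) ` T1" and ?T2 = "(\<lambda>t. t(z := \<not> b)) ` T2"
    have "card ?T1 * y ^ M' \<le> (1 + y) ^ card Z"
      by (rule order_trans[OF mult_right_mono T1(2)]) (use T1(1) y in \<open>auto intro: card_image_le\<close>)
    then have cT1: "card ?T1 * y ^ M \<le> y * (1 + y) ^ card Z" 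
      using y mult_left_mono[of _ _ y] by (fastforce simp: Suc algebra_simps)
    have "card (?T1 \<union> ?T2) * y ^ M \<le> (card ?T1 + card ?T2) * y ^ M"
      using y by (intro mult_right_mono) (auto simp: card_Un_le simp flip: of_nat_add)
    also have "\<dots> \<le> y * (1 + y) ^ card Z + (1 + y) ^ card Z"
      using cT1 cT2 by (simp add: algebra_simps)
    also have "\<dots> = (1 + y) ^ card (insert z Z)" using insert.hyps by (simp add: algebra_simps)
    finally have "card (?T1 \<union> ?T2) * y ^ M \<le> (1 + y) ^ card (insert z Z)" .
    moreover have "\<exists>t\<in>?T1 \<union> ?T2. \<forall>z'\<in>insert z Z. x \<notin> P z' (\<not> t z')" if x: "x \<in> S" for x
    proof (cases "x \<in> P z b")
      case True
      then obtain t where "t \<in> T1" "\<forall>z\<in>Z. x \<notin> P z (\<not> t z)" using T1(3) x by (auto simp: A_def)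
      then show ?thesis using True dz \<open>z \<notin> Z\<close> by (intro bexI[of _ "t(z := b)"]) auto
    next
      case False
      then show ?thesis using imT2[OF x] by blast
    qed
    ultimately show ?thesis using T1(1) T2(1) by (intro exI[of _ "?T1 \<union> ?T2"]) auto
  qed
qed

text \<open>By \<open>halving_cover\<close>, a set \<open>S\<close> that shatters fewer than
  \<open>2 ^ (M + 1)\<close> sets is described by at most \<open>(1 + y) ^ n / y ^ M\<close>
  patterns, where \<open>n = card Z\<close>. As exponentially many patterns are required,
  \<open>M\<close> is at least proportional to \<open>n\<close>. So exponentially many sets are
  shattered, and one of them has proportional size.\<close>

lemma shattered_of_large_cover:
  fixes c :: real
  assumes "c > 0"
  obtains q :: real where "q > 0"
    and "\<And>(Z::'z set) (P::'z \<Rightarrow> bool \<Rightarrow> 'x set) S. finite Z \<Longrightarrow> Z \<noteq> {} \<Longrightarrow>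
           (\<forall>z\<in>Z. P z False \<inter> P z True = {}) \<Longrightarrow>
           (\<And>T. finite T \<Longrightarrow> (\<forall>x\<in>S. \<exists>t\<in>T. \<forall>z\<in>Z. x \<notin> P z (\<not> t z)) \<Longrightarrow> exp (c * card Z) \<le> card T) \<Longrightarrow>
           \<exists>J\<in>shattered Z P S. q * card Z \<le> card J"
proof -
  \<comment> \<open>\<open>y \<le> c / 3\<close> gives
    \<open>(1 + y) ^ n \<le> exp (c * n / 3)\<close>, so \<open>(1 / y) ^ M\<close> must reach
    \<open>exp (2 * c * n / 3)\<close>. The constant \<open>c'\<close> below is a resulting rate
    with \<open>2 ^ M \<ge> exp (c' * n)\<close>.\<close>
  define y where "y = min (1/2) (c/3)"
  have y: "0 < y" "y < 1" "y \<le> c/3" using assms by (auto simp: y_def)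
  have lny: "- ln y > 0" using y by simp
  define c' where "c' = c * ln 2 / (3 * - ln y)"
  have "c' > 0" using lny assms unfolding c'_def by (intro divide_pos_pos mult_pos_pos) auto
  from large_member_of_large_family[OF this, where 'z='z] obtain q :: real where "q > 0" and
    q: "\<And>(Z::'z set) \<J>. finite Z \<Longrightarrow> Z \<noteq> {} \<Longrightarrow> \<J> \<subseteq> Pow Z \<Longrightarrow> exp (c' * card Z) \<le> card \<J> \<Longrightarrow>
           \<exists>J\<in>\<J>. q * card Z \<le> card J" by blast
  have "\<exists>J\<in>shattered Z P S. q * card Z \<le> card J"
    if Z: "finite Z" "Z \<noteq> {}" and P: "\<forall>z\<in>Z. P z False \<inter> P z True = {}"
      and T: "\<And>T. finite T \<Longrightarrow> (\<forall>x\<in>S. \<exists>t\<in>T. \<forall>z\<in>Z. x \<notin> P z (\<not> t z)) \<Longrightarrow> exp (c * card Z) \<le> card T"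
    for Z :: "'z set" and P :: "'z \<Rightarrow> bool \<Rightarrow> 'x set" and S
  proof (rule q[OF Z])
    have N: "card Z > 0" using Z by (simp add: card_gt_0_iff)
    show "shattered Z P S \<subseteq> Pow Z" by (auto simp: shattered_def)
    have "S \<noteq> {}" using T[of "{}"] by auto
    then have "{} \<in> shattered Z P S" by (auto simp: shattered_def)
    then have "1 \<le> card (shattered Z P S)"
      using finite_shattered[OF Z(1)] by (metis One_nat_def Suc_leI card_gt_0_iff empty_iff)
    then obtain M where M: "2 ^ M \<le> card (shattered Z P S)" "card (shattered Z P S) < 2 ^ (M + 1)"
      using ex_power_ivl1[of 2 "card (shattered Z P S)"] by auto
    from halving_cover[OF Z(1) _ y(1) _ , of P S M] P M y obtain U :: "('z \<Rightarrow> bool) set" where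
      U: "finite U" "card U * y ^ M \<le> (1 + y) ^ card Z" "\<forall>x\<in>S. \<exists>t\<in>U. \<forall>z\<in>Z. x \<notin> P z (\<not> t z)"
      by auto
    have "exp (c * card Z) * y ^ M \<le> card U * y ^ M"
      using T[OF U(1,3)] y by (intro mult_right_mono) auto
    also note U(2)
    also have "(1 + y) ^ card Z \<le> exp y ^ card Z" using y exp_ge_add_one_self[of y] by (intro power_mono) auto
    also have "y ^ M = exp (M * ln y)" using y by (simp add: exp_of_nat_mult)
    also have "exp y ^ card Z = exp (card Z * y)" by (simp add: exp_of_nat_mult)
    finally have "c * card Z + M * ln y \<le> card Z * y" by (simp flip: exp_add)
    moreover have "card Z * y \<le> card Z * (c / 3)" using y by (intro mult_left_mono) auto
    ultimately have "card Z * (2 * c / 3) \<le> M * - ln y" by (simp add: field_simps)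
    moreover have "c' * card Z * - ln y = card Z * (c / 3) * ln 2" using lny by (simp add: c'_def field_simps)
    moreover have "card Z * (c / 3) * ln 2 \<le> card Z * (2 * c / 3) * ln 2"
      using assms N by (intro mult_right_mono mult_left_mono) auto
    moreover have "card Z * (2 * c / 3) * ln 2 \<le> M * - ln y * ln 2" if "card Z * (2 * c / 3) \<le> M * - ln y"
      using that by (intro mult_right_mono) auto
    ultimately have "c' * card Z * - ln y \<le> M * - ln y * ln 2" by linarith
    then have "(c' * card Z) * - ln y \<le> (M * ln 2) * - ln y" by (simp add: mult_ac)
    then have "c' * card Z \<le> M * ln 2" using lny by (simp only: mult_le_cancel_right)
    then have "exp (c' * card Z) \<le> exp (M * ln 2)" by simp
    also have "\<dots> = 2 ^ M" by (simp add: exp_of_nat_mult)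
    also have "\<dots> \<le> card (shattered Z P S)" using M(1) by (simp flip: of_nat_le_iff)
    finally show "exp (c' * card Z) \<le> card (shattered Z P S)" .
  qed
  then show ?thesis by (rule that[OF \<open>q > 0\<close>])
qed

section \<open>Families of positive density\<close>

definition full_projections :: "'z set \<Rightarrow> 'v set \<Rightarrow> ('z \<Rightarrow> 'v) set \<Rightarrow> 'z set set" where
  "full_projections Z V S = {K. K \<subseteq> Z \<and> (\<forall>\<omega>. (\<forall>z\<in>K. \<omega> z \<in> V) \<longrightarrow> (\<exists>\<sigma>\<in>S. \<forall>z\<in>K. \<sigma> z = \<omega> z))}"

text \<open>Pajor's form of the Sauer--Shelah bound with \<open>card V\<close> labels: slice
  \<open>S\<close> by the label at the new coordinate and compare the full sets of the slices with
  those of \<open>S\<close>. The last hypothesis says that members of \<open>S\<close> are already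
  distinguished on \<open>Z\<close>.\<close>

lemma card_le_full_projections:
  assumes "finite Z" "finite V" "card V \<ge> 2" "finite S"
    and "\<And>\<sigma> z. \<sigma> \<in> S \<Longrightarrow> z \<in> Z \<Longrightarrow> \<sigma> z \<in> V"
    and "\<And>\<sigma> \<tau>. \<sigma> \<in> S \<Longrightarrow> \<tau> \<in> S \<Longrightarrow> (\<forall>z\<in>Z. \<sigma> z = \<tau> z) \<Longrightarrow> \<sigma> = \<tau>"
  shows "card S \<le> (card V - 1) ^ card Z * card (full_projections Z V S)"
  using assms(1,4,5,6)
proof (induction Z arbitrary: S rule: finite_induct)
  case empty
  show ?case
  proof (cases "S = {}")
    case False
    then obtain \<sigma> where "S = {\<sigma>}" using empty.prems(3) by blast
    then have "full_projections {} V S = {{}}" by (auto simp: full_projections_def)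
    then show ?thesis using \<open>S = {\<sigma>}\<close> by simp
  qed auto
next
  case (insert z Z)
  let ?k = "card V"
  define A where "A u = {\<sigma>\<in>S. \<sigma> z = u}" for u
  let ?f = "\<lambda>u. full_projections Z V (A u)"
  let ?g = "full_projections (insert z Z) V S"
  have IH: "card (A u) \<le> (?k - 1) ^ card Z * card (?f u)" for u
  proof (rule insert.IH)
    show "\<sigma> = \<tau>" if "\<sigma> \<in> A u" "\<tau> \<in> A u" "\<forall>z\<in>Z. \<sigma> z = \<tau> z" for \<sigma> \<tau>
      using that by (intro insert.prems(3)) (auto simp: A_def)
  qed (use insert.prems in \<open>auto simp: A_def\<close>)
  have "S = (\<Union>u\<in>V. A u)" using insert.prems(2) by (auto simp: A_def)
  then have "card S \<le> (\<Sum>u\<in>V. card (A u))" using card_UN_le[OF \<open>finite V\<close>] by metis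
  also have "\<dots> \<le> (\<Sum>u\<in>V. (?k - 1) ^ card Z * card (?f u))" using IH by (rule sum_mono)
  also have "\<dots> = (?k - 1) ^ card Z * (\<Sum>u\<in>V. card (?f u))" by (simp add: sum_distrib_left)
  also have "(\<Sum>u\<in>V. card (?f u)) = (\<Sum>u\<in>V. \<Sum>K\<in>Pow Z. of_bool (K \<in> ?f u))"
  proof (rule sum.cong)
    fix u
    have "Pow Z \<inter> {K. K \<in> ?f u} = ?f u" by (auto simp: full_projections_def)
    then show "card (?f u) = (\<Sum>K\<in>Pow Z. of_bool (K \<in> ?f u))"
      using insert.hyps by simp
  qed auto
  also have "\<dots> = (\<Sum>K\<in>Pow Z. \<Sum>u\<in>V. of_bool (K \<in> ?f u))" by (rule sum.swap)
  \<comment> \<open>Let \<open>K\<close> be full for \<open>j\<close> of the \<open>k\<close>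
    slices. If \<open>0 < j < k\<close>, then \<open>K\<close> is full for \<open>S\<close> and
    \<open>j \<le> k - 1\<close>. If \<open>j = k\<close>, then \<open>K\<close> and
    \<open>insert z K\<close> are both full for \<open>S\<close>, and
    \<open>k \<le> 2 * (k - 1)\<close> because \<open>k \<ge> 2\<close>.\<close>
  also have "\<dots> \<le> (\<Sum>K\<in>Pow Z. (?k - 1) * (of_bool (K \<in> ?g) + of_bool (insert z K \<in> ?g)))"
  proof (rule sum_mono)
    fix K assume K: "K \<in> Pow Z"
    have s: "(\<Sum>u\<in>V. of_bool (K \<in> ?f u)) = card {u\<in>V. K \<in> ?f u}"
      using \<open>finite V\<close> by (simp add: Collect_conj_eq)
    have 1: "K \<in> ?g" if "K \<in> ?f u" for u
      using that unfolding full_projections_def A_def by fast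
    have 2: "insert z K \<in> ?g" if all: "\<forall>u\<in>V. K \<in> ?f u"
      unfolding full_projections_def
    proof (intro CollectI conjI allI impI)
      show "insert z K \<subseteq> insert z Z" using K by auto
      fix \<omega> assume \<omega>: "\<forall>z\<in>insert z K. \<omega> z \<in> V"
      then have "K \<in> ?f (\<omega> z)" using all by auto
      then obtain \<sigma> where "\<sigma> \<in> A (\<omega> z)" "\<forall>z\<in>K. \<sigma> z = \<omega> z"
        using \<omega> unfolding full_projections_def by blast
      then show "\<exists>\<sigma>\<in>S. \<forall>z\<in>insert z K. \<sigma> z = \<omega> z" by (auto simp: A_def)
    qed
    show "(\<Sum>u\<in>V. of_bool (K \<in> ?f u)) \<le> (?k - 1) * (of_bool (K \<in> ?g) + of_bool (insert z K \<in> ?g))"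
    proof (cases "\<forall>u\<in>V. K \<in> ?f u")
      case True
      moreover have "V \<noteq> {}" using \<open>card V \<ge> 2\<close> by auto
      ultimately have "K \<in> ?g" "insert z K \<in> ?g" using 1 2 by auto
      moreover have "card {u\<in>V. K \<in> ?f u} \<le> ?k" using \<open>finite V\<close> by (intro card_mono) auto
      ultimately show ?thesis using s \<open>card V \<ge> 2\<close> by auto
    next
      case False
      show ?thesis
      proof (cases "\<exists>u\<in>V. K \<in> ?f u")
        case True
        from False have "{u\<in>V. K \<in> ?f u} \<subset> V" by auto
        then have "card {u\<in>V. K \<in> ?f u} < ?k" using \<open>finite V\<close> by (rule psubset_card_mono[rotated])
        moreover have "K \<in> ?g" using True 1 by auto
        ultimately show ?thesis using s by auto
      next
        case False
        then have "{u\<in>V. K \<in> ?f u} = {}" by auto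
        then show ?thesis using s by simp
      qed
    qed
  qed
  also have "\<dots> = (?k - 1) * card ?g"
  proof -
    have "?g = Pow (insert z Z) \<inter> {K. K \<in> ?g}" by (auto simp: full_projections_def)
    then have "card ?g = (\<Sum>K\<in>Pow (insert z Z). of_bool (K \<in> ?g))"
      using insert.hyps by simp
    also have "\<dots> = (\<Sum>K\<in>Pow Z. of_bool (K \<in> ?g)) + (\<Sum>K\<in>insert z ` Pow Z. of_bool (K \<in> ?g))"
      unfolding Pow_insert using insert.hyps by (intro sum.union_disjoint) auto
    also have "(\<Sum>K\<in>insert z ` Pow Z. of_bool (K \<in> ?g)) = (\<Sum>K\<in>Pow Z. of_bool (insert z K \<in> ?g))"
      by (rule sum.reindex_cong[of "insert z"]) (use insert.hyps in \<open>auto simp: inj_on_def insert_ident subset_eq\<close>)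
    finally show ?thesis by (simp add: sum_distrib_left[symmetric] sum.distrib)
  qed
  finally show ?case using insert.hyps by (simp add: mult_ac)
qed

text \<open>With one label forbidden everywhere, \<open>(card V - 1) ^ n\<close> patterns have no
  nonempty full projection. A further factor \<open>exp (b * n)\<close> forces at least that many
  full coordinate sets, hence one of proportional size.\<close>

lemma large_full_projection:
  fixes b :: real and V :: "'v set"
  assumes "b > 0" "finite V" "card V \<ge> 2"
  obtains q :: real where "q > 0"
    and "\<And>(Z::'z set) S. finite Z \<Longrightarrow> Z \<noteq> {} \<Longrightarrow> S \<subseteq> PiE Z (\<lambda>_. V) \<Longrightarrow>
           ((card V - 1) * exp b) ^ card Z \<le> card S \<Longrightarrow>
           \<exists>K\<in>full_projections Z V S. q * card Z \<le> card K"
proof -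
  from large_member_of_large_family[OF assms(1), where 'z='z] obtain q :: real where "q > 0" and
    q: "\<And>(Z::'z set) \<J>. finite Z \<Longrightarrow> Z \<noteq> {} \<Longrightarrow> \<J> \<subseteq> Pow Z \<Longrightarrow> exp (b * card Z) \<le> card \<J> \<Longrightarrow>
           \<exists>J\<in>\<J>. q * card Z \<le> card J" by blast
  have "\<exists>K\<in>full_projections Z V S. q * card Z \<le> card K"
    if Z: "finite Z" "Z \<noteq> {}" and S: "S \<subseteq> PiE Z (\<lambda>_. V)"
      and le: "((card V - 1) * exp b) ^ card Z \<le> card S" for Z :: "'z set" and S
  proof (rule q[OF Z])
    show "full_projections Z V S \<subseteq> Pow Z" by (auto simp: full_projections_def)
    have "finite S" by (rule finite_subset[OF S]) (use Z assms in \<open>auto intro: finite_PiE\<close>)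
    have "card S \<le> (card V - 1) ^ card Z * card (full_projections Z V S)"
    proof (rule card_le_full_projections[OF Z(1) assms(2,3) \<open>finite S\<close>])
      show "\<sigma> = \<tau>" if "\<sigma> \<in> S" "\<tau> \<in> S" "\<forall>z\<in>Z. \<sigma> z = \<tau> z" for \<sigma> \<tau>
        by (rule PiE_ext[of _ Z "\<lambda>_. V"]) (use S that in auto)
    qed (use S in auto)
    then have "real (card S) \<le> real ((card V - 1) ^ card Z * card (full_projections Z V S))"
      by (simp only: of_nat_le_iff)
    with le have "(card V - 1) ^ card Z * exp b ^ card Z
        \<le> (card V - 1) ^ card Z * real (card (full_projections Z V S))"
      by (simp add: power_mult_distrib)
    then have "exp b ^ card Z \<le> card (full_projections Z V S)"
      using assms(3) by (subst (asm) mult_le_cancel_left_pos) auto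
    then show "exp (b * card Z) \<le> card (full_projections Z V S)"
      by (simp add: exp_of_nat_mult mult.commute[of b])
  qed
  then show ?thesis by (rule that[OF \<open>q > 0\<close>])
qed

section \<open>Independent positions and densities of colour families in a group action\<close>

context group_action
begin

lemma group_G: "group G"
  using group_hom by (rule group_hom.axioms(1))

lemma action_closed: "g \<in> carrier G \<Longrightarrow> x \<in> E \<Longrightarrow> \<phi> g x \<in> E"
  using element_image by blast

text \<open>
  A colour \<open>(g, C)\<close> carries a displacement \<open>g\<close>: used at position \<open>s\<close> it constrains the point at
  time \<open>g s\<close>. Joining tuples moves the relevant time away from the position, which without
  amenability could not be undone inside the given finite set \<open>F\<close>.
\<close>

definition independent :: "'v set \<Rightarrow> ('a \<times> ('v \<Rightarrow> 'c set)) set \<Rightarrow> 'a set \<Rightarrow> bool" where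
  "independent V \<A> J \<longleftrightarrow> (\<exists>c. (\<forall>s\<in>J. c s \<in> \<A>) \<and>
     (\<forall>\<omega>. (\<forall>s\<in>J. \<omega> s \<in> V) \<longrightarrow> (\<exists>x\<in>E. \<forall>s\<in>J. \<phi> (fst (c s) \<otimes> s) x \<in> snd (c s) (\<omega> s))))"

text \<open>\<open>J\<close> and its colouring may change with \<open>F\<close>; only
  \<open>q\<close> and the family are fixed. The bound over all finite \<open>F\<close> takes the
  place of density along a Folner sequence, which a general group does not have.\<close>

definition positive_density :: "'v set \<Rightarrow> ('a \<times> ('v \<Rightarrow> 'c set)) set \<Rightarrow> bool" where
  "positive_density V \<A> \<longleftrightarrow> (\<exists>q>0::real. \<forall>F. finite F \<longrightarrow> F \<noteq> {} \<longrightarrow> F \<subseteq> carrier G \<longrightarrow>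
     (\<exists>J\<subseteq>F. q * card F \<le> real (card J) \<and> independent V \<A> J))"

text \<open>
  Prescribe at random, for each position, the piece containing the \<open>v0\<close>-entry. On average
  \<open>(k - 1 + 1/p) ^ n\<close> of the \<open>k ^ n\<close> label patterns respect the prescription, which exceeds
  \<open>(k - 1) ^ n\<close> exponentially.
\<close>

lemma positive_density_split:
  fixes V :: "'v set"
  assumes "finite V" "card V \<ge> 2" "v0 \<in> V" "finite \<D>" "\<D> \<noteq> {}" "E \<subseteq> \<Union>\<D>" "positive_density V \<A>"
    and "fst ` \<A> \<subseteq> carrier G"
  shows "positive_density V {(g, C(v0 := C v0 \<inter> D)) | g C D. (g, C) \<in> \<A> \<and> D \<in> \<D>}"
    (is "positive_density V ?B")
proof -
  obtain q :: real where "q > 0" and q: "\<And>F. finite F \<Longrightarrow> F \<noteq> {} \<Longrightarrow> F \<subseteq> carrier G \<Longrightarrow>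
       \<exists>J\<subseteq>F. q * card F \<le> real (card J) \<and> independent V \<A> J"
    using assms(7) unfolding positive_density_def by blast
  let ?k = "real (card V)" and ?p = "real (card \<D>)"
  have k: "?k \<ge> 2" using assms(2) by linarith
  have p: "?p > 0" using assms(4,5) by (simp add: card_gt_0_iff)
  \<comment> \<open>Chosen so that \<open>(k - 1) * exp b = k - 1 + 1 / p\<close>, the average
    contribution of one position.\<close>
  define b where "b = ln (1 + 1 / (?p * (?k - 1)))"
  have "b > 0" unfolding b_def using k p by (intro ln_gt_zero) auto
  have expb: "?p * ((?k - 1) * exp b) = 1 + (?k - 1) * ?p"
  proof -
    have "exp b = 1 + 1 / (?p * (?k - 1))" unfolding b_def using k p by (intro exp_ln) (auto intro: add_pos_nonneg)
    then show ?thesis using k p by (simp add: field_simps)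
  qed
  obtain r :: real where "r > 0" and r: "\<And>(Z::'a set) S. finite Z \<Longrightarrow> Z \<noteq> {} \<Longrightarrow> S \<subseteq> PiE Z (\<lambda>_. V) \<Longrightarrow>
           ((card V - 1) * exp b) ^ card Z \<le> card S \<Longrightarrow> \<exists>K\<in>full_projections Z V S. r * card Z \<le> card K"
    using large_full_projection[OF \<open>b > 0\<close> assms(1,2), where 'z='a] by blast
  have "\<exists>K\<subseteq>F. (r * q) * card F \<le> real (card K) \<and> independent V ?B K"
    if F: "finite F" "F \<noteq> {}" "F \<subseteq> carrier G" for F
  proof -
    obtain J where J: "J \<subseteq> F" "q * card F \<le> real (card J)" "independent V \<A> J" using q[OF F] by blast
    have "q * card F > 0" using F \<open>q > 0\<close> by (simp add: card_gt_0_iff)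
    then have "J \<noteq> {}" using J(2) by auto
    have "finite J" using J F finite_subset by blast
    from J(3) obtain c where c: "\<And>s. s \<in> J \<Longrightarrow> c s \<in> \<A>" and
      cx: "\<And>\<omega>. (\<forall>s\<in>J. \<omega> s \<in> V) \<Longrightarrow> \<exists>x\<in>E. \<forall>s\<in>J. \<phi> (fst (c s) \<otimes> s) x \<in> snd (c s) (\<omega> s)"
      unfolding independent_def by blast
    let ?W = "PiE J (\<lambda>_. V)" and ?Q = "PiE J (\<lambda>_. \<D>)"
    \<comment> \<open>For each pattern \<open>\<omega>\<close>, fix a point realizing it and, at
      each position, a piece \<open>f s\<close> containing the image of that point at the relevant
      time.\<close>
    let ?P = "\<lambda>\<omega> x f. x \<in> E \<and> (\<forall>s\<in>J. \<phi> (fst (c s) \<otimes> s) x \<in> snd (c s) (\<omega> s)) \<and>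
        (\<forall>s\<in>J. f s \<in> \<D> \<and> (\<phi> (fst (c s) \<otimes> s) x \<in> E \<longrightarrow> \<phi> (fst (c s) \<otimes> s) x \<in> f s))"
    have "\<forall>\<omega>\<in>?W. \<exists>xf. ?P \<omega> (fst xf) (snd xf)"
    proof
      fix \<omega> assume "\<omega> \<in> ?W"
      then have "\<forall>s\<in>J. \<omega> s \<in> V" by auto
      with cx[of \<omega>] obtain x where x: "x \<in> E" "\<forall>s\<in>J. \<phi> (fst (c s) \<otimes> s) x \<in> snd (c s) (\<omega> s)" by blast
      have "\<forall>s\<in>J. \<exists>D. D \<in> \<D> \<and> (\<phi> (fst (c s) \<otimes> s) x \<in> E \<longrightarrow> \<phi> (fst (c s) \<otimes> s) x \<in> D)"
        using assms(5,6) by auto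
      from bchoice[OF this] obtain f where "?P \<omega> x f" using x by blast
      then show "\<exists>xf. ?P \<omega> (fst xf) (snd xf)" by (intro exI[of _ "(x, f)"]) simp
    qed
    from bchoice[OF this] obtain xf where xf: "\<forall>\<omega>\<in>?W. ?P \<omega> (fst (xf \<omega>)) (snd (xf \<omega>))" ..
    define x f where "x \<omega> = fst (xf \<omega>)" and "f \<omega> = snd (xf \<omega>)" for \<omega>
    have x: "\<And>\<omega>. \<omega> \<in> ?W \<Longrightarrow> x \<omega> \<in> E"
        "\<And>\<omega> s. \<omega> \<in> ?W \<Longrightarrow> s \<in> J \<Longrightarrow> \<phi> (fst (c s) \<otimes> s) (x \<omega>) \<in> snd (c s) (\<omega> s)"
      and f: "\<And>\<omega> s. \<omega> \<in> ?W \<Longrightarrow> s \<in> J \<Longrightarrow> f \<omega> s \<in> \<D>"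
        "\<And>\<omega> s. \<omega> \<in> ?W \<Longrightarrow> s \<in> J \<Longrightarrow> \<phi> (fst (c s) \<otimes> s) (x \<omega>) \<in> E \<Longrightarrow> \<phi> (fst (c s) \<otimes> s) (x \<omega>) \<in> f \<omega> s"
      using xf by (simp_all add: x_def f_def)
    \<comment> \<open>\<open>M \<omega>\<close> consists of the prescriptions \<open>d\<close> that
      name the actual piece wherever the label is \<open>v0\<close> and are free elsewhere;
      \<open>S d\<close> collects the patterns respecting \<open>d\<close>.\<close>
    define M where "M \<omega> = PiE J (\<lambda>s. if \<omega> s = v0 then {f \<omega> s} else \<D>)" for \<omega>
    define S where "S d = {\<omega>\<in>?W. d \<in> M \<omega>}" for d
    have finW: "finite ?W" "finite ?Q" using \<open>finite J\<close> assms(1,4) by (auto intro: finite_PiE)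
    have Msub: "M \<omega> \<subseteq> ?Q" if "\<omega> \<in> ?W" for \<omega>
      unfolding M_def by (rule PiE_mono) (use f(1)[OF that] in auto)
    \<comment> \<open>Double counting of the pairs with \<open>d \<in> M \<omega>\<close>. The sum
      over patterns factorizes over positions: the label \<open>v0\<close> contributes 1, every
      other label \<open>p\<close>.\<close>
    have "(\<Sum>d\<in>?Q. real (card (S d))) = (\<Sum>d\<in>?Q. \<Sum>\<omega>\<in>?W. of_bool (d \<in> M \<omega>))"
      using finW by (simp add: S_def Collect_conj_eq)
    also have "\<dots> = (\<Sum>\<omega>\<in>?W. \<Sum>d\<in>?Q. of_bool (d \<in> M \<omega>))" by (rule sum.swap)
    also have "\<dots> = (\<Sum>\<omega>\<in>?W. real (card (M \<omega>)))"
    proof (rule sum.cong)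
      fix \<omega> assume "\<omega> \<in> ?W"
      then have "?Q \<inter> {d. d \<in> M \<omega>} = M \<omega>" using Msub[of \<omega>] by blast
      then show "(\<Sum>d\<in>?Q. of_bool (d \<in> M \<omega>)) = real (card (M \<omega>))" using finW by simp
    qed auto
    also have "\<dots> = (\<Sum>\<omega>\<in>?W. \<Prod>s\<in>J. if \<omega> s = v0 then 1 else ?p)"
      unfolding M_def using \<open>finite J\<close> by (intro sum.cong) (auto simp: card_PiE if_distrib cong: if_cong intro!: prod.cong)
    also have "\<dots> = (\<Prod>s\<in>J. \<Sum>v\<in>V. if v = v0 then 1 else ?p)"
      using \<open>finite J\<close> assms(1) by (intro prod_sum_PiE[symmetric]) auto
    also have "(\<Sum>v\<in>V. if v = v0 then 1 else ?p) = 1 + (?k - 1) * ?p"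
      using assms(1,3) k by (simp add: sum.remove[of V v0])
    finally have tot: "(\<Sum>d\<in>?Q. real (card (S d))) = (1 + (?k - 1) * ?p) ^ card J" by simp
    have "\<exists>d\<in>?Q. ((?k - 1) * exp b) ^ card J \<le> card (S d)"
    proof (rule ccontr)
      assume "\<not> ?thesis"
      then have "(\<Sum>d\<in>?Q. real (card (S d))) < (\<Sum>d\<in>?Q. ((?k - 1) * exp b) ^ card J)"
        using finW assms(5) by (intro sum_strict_mono) (auto simp: PiE_eq_empty_iff)
      also have "\<dots> = ?p ^ card J * ((?k - 1) * exp b) ^ card J"
        using \<open>finite J\<close> by (simp add: card_PiE)
      also have "\<dots> = (1 + (?k - 1) * ?p) ^ card J" by (simp add: expb flip: power_mult_distrib)
      finally show False using tot by simp
    qed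
    then obtain d where d: "d \<in> ?Q" "((?k - 1) * exp b) ^ card J \<le> card (S d)" by blast
    have "S d \<subseteq> ?W" by (auto simp: S_def)
    moreover have "real (card V - 1) = ?k - 1" using assms(2) by simp
    ultimately obtain K where K: "K \<in> full_projections J V (S d)" "r * card J \<le> card K"
      using r[OF \<open>finite J\<close> \<open>J \<noteq> {}\<close>, of "S d"] d(2) by auto
    have KJ: "K \<subseteq> J" using K by (auto simp: full_projections_def)
    let ?c = "\<lambda>s. (fst (c s), (snd (c s))(v0 := snd (c s) v0 \<inter> d s))"
    have "independent V ?B K" unfolding independent_def
    proof (intro exI[of _ ?c] conjI ballI allI impI)
      fix s assume "s \<in> K"
      then have "c s \<in> \<A>" "d s \<in> \<D>" using KJ c d(1) by auto
      then show "?c s \<in> ?B" by (metis (mono_tags, lifting) mem_Collect_eq prod.collapse)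
    next
      fix \<omega> assume "\<forall>s\<in>K. \<omega> s \<in> V"
      then obtain \<sigma> where \<sigma>: "\<sigma> \<in> S d" "\<forall>s\<in>K. \<sigma> s = \<omega> s" using K(1) by (auto simp: full_projections_def)
      then have \<sigma>W: "\<sigma> \<in> ?W" "d \<in> M \<sigma>" by (auto simp: S_def)
      show "\<exists>x\<in>E. \<forall>s\<in>K. \<phi> (fst (?c s) \<otimes> s) x \<in> snd (?c s) (\<omega> s)"
      proof (intro bexI[of _ "x \<sigma>"] ballI)
        fix s assume s: "s \<in> K"
        then have "s \<in> J" using KJ by auto
        note xs = x(2)[OF \<sigma>W(1) this] and fs = f(2)[OF \<sigma>W(1) this]
        show "\<phi> (fst (?c s) \<otimes> s) (x \<sigma>) \<in> snd (?c s) (\<omega> s)"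
        proof (cases "\<omega> s = v0")
          case True
          then have "d s = f \<sigma> s" using \<sigma>W(2) \<open>s \<in> J\<close> \<sigma>(2) s by (force simp: M_def PiE_iff)
          moreover have "fst (c s) \<otimes> s \<in> carrier G"
            using \<open>s \<in> J\<close> c J(1) F(3) assms(8) by (intro monoid.m_closed[OF group.is_monoid[OF group_G]]) auto
          ultimately show ?thesis using xs fs True \<sigma>(2) s action_closed[OF _ x(1)[OF \<sigma>W(1)]] by auto
        next
          case False
          then show ?thesis using xs \<sigma>(2) s by auto
        qed
      qed (use x(1) \<sigma>W in auto)
    qed
    moreover have "(r * q) * card F \<le> card K"
    proof -
      have "r * (q * card F) \<le> r * card J" using J(2) \<open>r > 0\<close> by (intro mult_left_mono) auto
      then show ?thesis using K(2) by (simp add: mult_ac)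
    qed
    ultimately show ?thesis using KJ J(1) by (intro exI[of _ K]) auto
  qed
  then show ?thesis unfolding positive_density_def
    using \<open>r > 0\<close> \<open>q > 0\<close> by (intro exI[of _ "r * q"] conjI allI impI mult_pos_pos)
qed


text \<open>Let \<open>F0\<close> be a maximal separated subset. Each \<open>t\<close> in
  \<open>F\<close> then satisfies \<open>e \<otimes> t = e' \<otimes> t'\<close> for some
  \<open>t'\<close> in \<open>F0\<close>, so it is one of at most
  \<open>card B * card B * card F0\<close> elements
  \<open>inv e \<otimes> (e' \<otimes> t')\<close>.\<close>

lemma separated_subset:
  assumes "finite F" "F \<subseteq> carrier G" "finite B" "B \<noteq> {}" "B \<subseteq> carrier G"
  obtains F0 where "F0 \<subseteq> F" "card F \<le> card B * card B * card F0"
    "\<And>t t' e e'. t \<in> F0 \<Longrightarrow> t' \<in> F0 \<Longrightarrow> e \<in> B \<Longrightarrow> e' \<in> B \<Longrightarrow> e \<otimes> t = e' \<otimes> t' \<Longrightarrow> t = t'"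
proof -
  interpret group G by (rule group_G)
  define sep where "sep A \<longleftrightarrow> (\<forall>t\<in>A. \<forall>t'\<in>A. \<forall>e\<in>B. \<forall>e'\<in>B. e \<otimes> t = e' \<otimes> t' \<longrightarrow> t = t')" for A
  have "finite {A. A \<subseteq> F \<and> sep A}" using assms(1) by simp
  moreover have "{} \<in> {A. A \<subseteq> F \<and> sep A}" by (simp add: sep_def)
  ultimately obtain F0 where F0: "F0 \<in> {A. A \<subseteq> F \<and> sep A}"
      and max: "\<forall>A\<in>{A. A \<subseteq> F \<and> sep A}. F0 \<le> A \<longrightarrow> F0 = A"
    using finite_has_maximal[of "{A. A \<subseteq> F \<and> sep A}"] by blast
  have "F \<subseteq> (\<lambda>(e, e', t). inv e \<otimes> (e' \<otimes> t)) ` (B \<times> B \<times> F0)"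
  proof
    fix t assume t: "t \<in> F"
    then have tc: "t \<in> carrier G" using assms(2) by auto
    have "\<exists>e\<in>B. \<exists>e'\<in>B. \<exists>t'\<in>F0. e \<otimes> t = e' \<otimes> t'"
    proof (cases "t \<in> F0")
      case True
      then show ?thesis using assms(4) by blast
    next
      case False
      then have "\<not> sep (insert t F0)" using max t F0 by blast
      then obtain a b e e' where "a \<in> insert t F0" "b \<in> insert t F0" "e \<in> B" "e' \<in> B" "e \<otimes> a = e' \<otimes> b" "a \<noteq> b"
        unfolding sep_def by blast
      moreover have "\<not> (a \<in> F0 \<and> b \<in> F0)" using calculation F0 unfolding sep_def by blast
      ultimately show ?thesis by (metis insertE)
    qed
    then obtain e e' t' where e: "e \<in> B" "e' \<in> B" "t' \<in> F0" "e \<otimes> t = e' \<otimes> t'" by blast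
    have "e \<in> carrier G" using e(1) assms(5) by auto
    then have "t = inv e \<otimes> (e' \<otimes> t')" using tc by (simp add: e(4)[symmetric] m_assoc[symmetric])
    then show "t \<in> (\<lambda>(e, e', t). inv e \<otimes> (e' \<otimes> t)) ` (B \<times> B \<times> F0)"
      using e by (intro image_eqI[of _ _ "(e, e', t')"]) auto
  qed
  moreover have "finite F0" using F0 assms(1) finite_subset by blast
  ultimately have "card F \<le> card (B \<times> B \<times> F0)" using assms(3) by (intro surj_card_le) auto
  then have "card F \<le> card B * card B * card F0" by (simp add: card_cartesian_product)
  then show ?thesis using F0 unfolding sep_def by (intro that[of F0]) blast+
qed

text \<open>For separated \<open>F0\<close> the products \<open>e \<otimes> t\<close> are distinct.
  Density applied to the set \<open>L\<close> of all of them puts on average at least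
  \<open>m\<close> points of \<open>J\<close> above each \<open>t\<close>, so a fixed proportion of
  the \<open>t\<close> attain \<open>m\<close>. Here \<open>J\<close> lies in \<open>L\<close>,
  while \<open>T\<close> lies in \<open>F\<close> and provides the positions of the new
  colours.\<close>

lemma positive_density_many_translates:
  fixes m :: nat
  assumes "positive_density V \<A>" "infinite (carrier G)" "m > 0"
  obtains B and q :: real where "finite B" "B \<subseteq> carrier G" "q > 0"
    "\<And>F. finite F \<Longrightarrow> F \<noteq> {} \<Longrightarrow> F \<subseteq> carrier G \<Longrightarrow> \<exists>J T. T \<subseteq> F \<and> q * card F \<le> card T \<and>
       independent V \<A> J \<and> J \<subseteq> carrier G \<and> (\<forall>t\<in>T. m \<le> card {e\<in>B. e \<otimes> t \<in> J}) \<and>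
       (\<forall>t\<in>T. \<forall>t'\<in>T. \<forall>e\<in>B. \<forall>e'\<in>B. e \<otimes> t = e' \<otimes> t' \<longrightarrow> t = t')"
proof -
  interpret group G by (rule group_G)
  obtain q :: real where "q > 0" and q: "\<And>F. finite F \<Longrightarrow> F \<noteq> {} \<Longrightarrow> F \<subseteq> carrier G \<Longrightarrow>
       \<exists>J\<subseteq>F. q * card F \<le> real (card J) \<and> independent V \<A> J"
    using assms(1) unfolding positive_density_def by blast
  \<comment> \<open>\<open>M\<close> is the size of \<open>B\<close>; this value ensures
    \<open>q * M \<ge> m\<close>.\<close>
  define M where "M = Suc (nat \<lceil>m / q\<rceil>)"
  have "M > 0" by (simp add: M_def)
  have "m / q \<le> M" unfolding M_def by linarith
  then have qM: "m \<le> q * M" using \<open>q > 0\<close> by (simp add: field_simps)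
  obtain B where B: "finite B" "card B = M" "B \<subseteq> carrier G"
    using infinite_arbitrarily_large[OF assms(2)] by blast
  have "B \<noteq> {}" using B \<open>M > 0\<close> by auto
  have "\<exists>J T. T \<subseteq> F \<and> 1 / M ^ 3 * card F \<le> card T \<and>
       independent V \<A> J \<and> J \<subseteq> carrier G \<and> (\<forall>t\<in>T. m \<le> card {e\<in>B. e \<otimes> t \<in> J}) \<and>
       (\<forall>t\<in>T. \<forall>t'\<in>T. \<forall>e\<in>B. \<forall>e'\<in>B. e \<otimes> t = e' \<otimes> t' \<longrightarrow> t = t')"
    if F: "finite F" "F \<noteq> {}" "F \<subseteq> carrier G" for F
  proof -
    obtain F0 where F0: "F0 \<subseteq> F" "card F \<le> card B * card B * card F0"
      and sep: "\<And>t t' e e'. t \<in> F0 \<Longrightarrow> t' \<in> F0 \<Longrightarrow> e \<in> B \<Longrightarrow> e' \<in> B \<Longrightarrow> e \<otimes> t = e' \<otimes> t' \<Longrightarrow> t = t'"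
      by (rule separated_subset[OF F(1,3) B(1) \<open>B \<noteq> {}\<close> B(3)]) blast
    have finF0: "finite F0" using F0 F finite_subset by blast
    have "card F > 0" using F by (simp add: card_gt_0_iff)
    then have "F0 \<noteq> {}" using F0(2) by auto
    define L where "L = (\<lambda>(e, t). e \<otimes> t) ` (B \<times> F0)"
    have inj: "inj_on (\<lambda>(e, t). e \<otimes> t) (B \<times> F0)"
    proof (rule inj_onI, clarsimp)
      fix e t e' t' assume *: "e \<in> B" "t \<in> F0" "e' \<in> B" "t' \<in> F0" "e \<otimes> t = e' \<otimes> t'"
      then have "t = t'" using sep by blast
      then show "e = e' \<and> t = t'" using * F0(1) F(3) B(3) by (metis right_cancel subsetD)
    qed
    have cardL: "card L = M * card F0"
      unfolding L_def by (simp add: card_image[OF inj] card_cartesian_product B(2))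
    have L: "finite L" "L \<noteq> {}" "L \<subseteq> carrier G"
      using finF0 B(1,3) \<open>F0 \<noteq> {}\<close> \<open>B \<noteq> {}\<close> F0(1) F(3) by (auto simp: L_def)
    obtain J where J: "J \<subseteq> L" "q * card L \<le> real (card J)" "independent V \<A> J" using q[OF L] by blast
    define N where "N t = {e\<in>B. e \<otimes> t \<in> J}" for t
    define T where "T = {t\<in>F0. m \<le> card (N t)}"
    have finN: "finite (N t)" and cN: "card (N t) \<le> M" for t
      using B(1,2) by (auto simp: N_def intro: card_mono)
    have "J \<subseteq> (\<lambda>(t, e). e \<otimes> t) ` (SIGMA t:F0. N t)"
      using J(1) by (force simp: L_def N_def)
    then have "card J \<le> card (SIGMA t:F0. N t)" using finF0 finN by (intro surj_card_le) auto
    also have "\<dots> = (\<Sum>t\<in>F0. card (N t))" using finF0 finN by simp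
    finally have "real (card J) \<le> (\<Sum>t\<in>F0. real (card (N t)))" by (simp flip: of_nat_sum)
    \<comment> \<open>Counts are integers, so a \<open>t\<close> outside \<open>T\<close> has at
      most \<open>m - 1\<close> points of \<open>J\<close> above it. This gap of one below the
      average gives \<open>card F0 \<le> M * card T\<close>.\<close>
    also have "\<dots> \<le> (\<Sum>t\<in>F0. real m - 1 + M * of_bool (t \<in> T))"
    proof (rule sum_mono)
      fix t assume "t \<in> F0"
      then show "real (card (N t)) \<le> real m - 1 + M * of_bool (t \<in> T)"
      proof (cases "t \<in> T")
        case True
        then show ?thesis using cN[of t] \<open>m > 0\<close> by simp
      next
        case False
        then have "card (N t) < m" using \<open>t \<in> F0\<close> by (auto simp: T_def)
        then show ?thesis using False by simp
      qed
    qed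
    also have "\<dots> = (real m - 1) * card F0 + M * card T"
    proof -
      have "F0 \<inter> {t. t \<in> T} = T" by (auto simp: T_def)
      then show ?thesis using finF0 by (simp add: sum.distrib sum_distrib_left[symmetric])
    qed
    finally have "real (card J) \<le> (real m - 1) * card F0 + M * card T" .
    moreover have "real m * card F0 \<le> card J"
    proof -
      have "real m * card F0 \<le> q * M * card F0" using qM by (intro mult_right_mono) auto
      then show ?thesis using J(2) by (simp add: cardL mult_ac)
    qed
    ultimately have "card F0 \<le> real M * card T" by (simp add: algebra_simps)
    then have "real M * M * card F0 \<le> real M * M * (M * card T)" by (intro mult_left_mono) auto
    moreover have "real (card F) \<le> real M * M * card F0" using F0(2) B(2) by (simp flip: of_nat_mult)
    ultimately have "card F \<le> real M ^ 3 * card T" by (simp add: power3_eq_cube mult_ac)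
    then have "1 / M ^ 3 * card F \<le> card T" using \<open>M > 0\<close> by (simp add: field_simps)
    moreover have "T \<subseteq> F0" by (auto simp: T_def)
    moreover have "\<forall>t\<in>T. m \<le> card {e\<in>B. e \<otimes> t \<in> J}" by (simp add: T_def N_def)
    moreover have "\<forall>t\<in>T. \<forall>t'\<in>T. \<forall>e\<in>B. \<forall>e'\<in>B. e \<otimes> t = e' \<otimes> t' \<longrightarrow> t = t'"
      using sep by (auto simp: T_def)
    moreover have "J \<subseteq> carrier G" using J(1) L(3) by simp
    ultimately show ?thesis using F0(1) J(3) by (intro exI[of _ J] exI[of _ T] conjI) auto
  qed
  then show ?thesis using \<open>M > 0\<close> by (intro that[OF B(1,3), of "1 / M ^ 3"]) auto
qed

text \<open>Two positions \<open>e1 \<otimes> t\<close> and \<open>e2 \<otimes> t\<close> of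
  \<open>J\<close> are merged into the position \<open>t\<close> with displacement
  \<open>fst a1 \<otimes> e1\<close>. The second constraint is then read after a further move by
  \<open>tr e1 e2 a1 a2\<close>, which is the \<open>h\<close> of the conclusion. Since
  \<open>B\<close> is fixed before \<open>F\<close>, only finitely many new colours arise.\<close>

lemma positive_density_join_translate:
  fixes u w :: "'w \<Rightarrow> 'v"
  assumes fin: "finite \<A>" and fst: "fst ` \<A> \<subseteq> carrier G"
    and pd: "positive_density V \<A>" "infinite (carrier G)" and K: "finite K"
    and uw: "\<And>v. v \<in> V' \<Longrightarrow> u v \<in> V" "\<And>v. v \<in> V' \<Longrightarrow> w v \<in> V"
  obtains \<B> where "finite \<B>" "fst ` \<B> \<subseteq> carrier G" "positive_density V' \<B>"
    "\<And>C'. C' \<in> snd ` \<B> \<Longrightarrow> \<exists>C1\<in>snd ` \<A>. \<exists>C2\<in>snd ` \<A>. \<exists>h\<in>carrier G - K.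
       C' = (\<lambda>v. C1 (u v) \<inter> {x\<in>E. \<phi> h x \<in> C2 (w v)})"
proof -
  interpret group G by (rule group_G)
  have mult_inv_cancel: "a \<otimes> inv b \<otimes> b = a" if "a \<in> carrier G" "b \<in> carrier G" for a b
    using that by (simp add: m_assoc)
  \<comment> \<open>For fixed \<open>e1\<close>, each displacement and each \<open>k\<close> in
    \<open>K\<close> exclude at most one \<open>e2\<close>; \<open>e2 = e1\<close> is excluded too,
    and one candidate must remain.\<close>
  define m where "m = card (fst ` \<A>) * card K + 2"
  obtain B and q :: real where B: "finite B" "B \<subseteq> carrier G" "q > 0" and
    q: "\<And>F. finite F \<Longrightarrow> F \<noteq> {} \<Longrightarrow> F \<subseteq> carrier G \<Longrightarrow> \<exists>J T. T \<subseteq> F \<and> q * card F \<le> card T \<and>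
       independent V \<A> J \<and> J \<subseteq> carrier G \<and> (\<forall>t\<in>T. m \<le> card {e\<in>B. e \<otimes> t \<in> J}) \<and>
       (\<forall>t\<in>T. \<forall>t'\<in>T. \<forall>e\<in>B. \<forall>e'\<in>B. e \<otimes> t = e' \<otimes> t' \<longrightarrow> t = t')"
    by (rule positive_density_many_translates[OF pd, of m]) (simp add: m_def, blast)
  define tr where "tr e1 e2 a1 a2 = (fst a2 \<otimes> e2) \<otimes> inv (fst a1 \<otimes> e1)" for e1 e2 and a1 a2 :: "'a \<times> ('v \<Rightarrow> 'c set)"
  define mk where "mk e1 e2 a1 a2 =
    (fst a1 \<otimes> e1, \<lambda>v. snd a1 (u v) \<inter> {x\<in>E. \<phi> (tr e1 e2 a1 a2) x \<in> snd a2 (w v)})" for e1 e2 a1 a2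
  define \<B> where "\<B> = {mk e1 e2 a1 a2 | e1 e2 a1 a2.
      e1 \<in> B \<and> e2 \<in> B \<and> a1 \<in> \<A> \<and> a2 \<in> \<A> \<and> tr e1 e2 a1 a2 \<notin> K}"
  have trc: "tr e1 e2 a1 a2 \<in> carrier G" if "e1 \<in> B" "e2 \<in> B" "a1 \<in> \<A>" "a2 \<in> \<A>" for e1 e2 a1 a2
    using that fst B(2) by (simp add: tr_def image_subset_iff subset_iff)
  have "\<B> \<subseteq> (\<lambda>(e1, e2, a1, a2). mk e1 e2 a1 a2) ` (B \<times> B \<times> \<A> \<times> \<A>)"
    by (force simp: \<B>_def)
  then have 1: "finite \<B>" by (rule finite_subset) (use B fin in auto)
  have 2: "fst ` \<B> \<subseteq> carrier G" using fst B(2) by (auto simp: \<B>_def mk_def image_subset_iff subset_iff)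
  have 3: "\<exists>C1\<in>snd ` \<A>. \<exists>C2\<in>snd ` \<A>. \<exists>h\<in>carrier G - K.
       C' = (\<lambda>v. C1 (u v) \<inter> {x\<in>E. \<phi> h x \<in> C2 (w v)})" if "C' \<in> snd ` \<B>" for C'
  proof -
    from that obtain e1 e2 a1 a2 where "e1 \<in> B" "e2 \<in> B" "a1 \<in> \<A>" "a2 \<in> \<A>" "tr e1 e2 a1 a2 \<notin> K"
      "C' = snd (mk e1 e2 a1 a2)" by (auto simp: \<B>_def)
    then show ?thesis using trc[of e1 e2 a1 a2]
      by (intro bexI[of _ "snd a1"] bexI[of _ "snd a2"] bexI[of _ "tr e1 e2 a1 a2"]) (auto simp: mk_def)
  qed
  have "\<exists>T\<subseteq>F. q * card F \<le> real (card T) \<and> independent V' \<B> T"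
    if F: "finite F" "F \<noteq> {}" "F \<subseteq> carrier G" for F
  proof -
    from q[OF F] obtain J T where JT: "T \<subseteq> F \<and> q * card F \<le> card T \<and>
       independent V \<A> J \<and> J \<subseteq> carrier G \<and> (\<forall>t\<in>T. m \<le> card {e\<in>B. e \<otimes> t \<in> J}) \<and>
       (\<forall>t\<in>T. \<forall>t'\<in>T. \<forall>e\<in>B. \<forall>e'\<in>B. e \<otimes> t = e' \<otimes> t' \<longrightarrow> t = t')" by (elim exE)
    then have T: "T \<subseteq> F" "q * card F \<le> card T" and J: "independent V \<A> J" "J \<subseteq> carrier G"
      and many: "\<And>t. t \<in> T \<Longrightarrow> m \<le> card {e\<in>B. e \<otimes> t \<in> J}"
      and sep: "\<And>t t' e e'. t \<in> T \<Longrightarrow> t' \<in> T \<Longrightarrow> e \<in> B \<Longrightarrow> e' \<in> B \<Longrightarrow> e \<otimes> t = e' \<otimes> t' \<Longrightarrow> t = t'"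
      by (simp_all, blast)
    from J(1) obtain c where c: "\<And>s. s \<in> J \<Longrightarrow> c s \<in> \<A>" and
      cx: "\<And>\<omega>. (\<forall>s\<in>J. \<omega> s \<in> V) \<Longrightarrow> \<exists>x\<in>E. \<forall>s\<in>J. \<phi> (fst (c s) \<otimes> s) x \<in> snd (c s) (\<omega> s)"
      unfolding independent_def by blast
    have "q * card F > 0" using F B(3) by (simp add: card_gt_0_iff)
    then obtain t0 where "t0 \<in> T" using T(2) by fastforce
    have Tc: "T \<subseteq> carrier G" using T F by auto
    let ?P = "\<lambda>t e1 e2. e1 \<in> B \<and> e2 \<in> B \<and> e1 \<otimes> t \<in> J \<and> e2 \<otimes> t \<in> J \<and> e1 \<noteq> e2 \<and>
        tr e1 e2 (c (e1 \<otimes> t)) (c (e2 \<otimes> t)) \<notin> K"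
    have "\<forall>t\<in>T. \<exists>e. ?P t (fst e) (snd e)"
    proof
      fix t assume t: "t \<in> T"
      let ?N = "{e\<in>B. e \<otimes> t \<in> J}"
      have "?N \<noteq> {}" using many[OF t] by (intro notI) (simp add: m_def)
      then obtain e1 where e1: "e1 \<in> B" "e1 \<otimes> t \<in> J" by blast
      let ?g1 = "fst (c (e1 \<otimes> t))"
      let ?bad = "(\<lambda>(g, k). inv g \<otimes> (k \<otimes> (?g1 \<otimes> e1))) ` (fst ` \<A> \<times> K)"
      have "card (insert e1 ?bad) \<le> Suc (card ?bad)" by (rule card_insert_le_m1) auto
      also have "card ?bad \<le> card (fst ` \<A> \<times> K)" by (rule card_image_le) (use fin K in auto)
      also have "Suc \<dots> < m" by (simp add: m_def card_cartesian_product)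
      also have "m \<le> card ?N" by (rule many[OF t])
      finally have "\<not> ?N \<subseteq> insert e1 ?bad" 
        using card_mono[of "insert e1 ?bad" ?N] fin K by (auto simp: not_le)
      then obtain e2 where e2: "e2 \<in> B" "e2 \<otimes> t \<in> J" "e2 \<noteq> e1" "e2 \<notin> ?bad" by blast
      let ?g2 = "fst (c (e2 \<otimes> t))"
      have g: "?g1 \<in> carrier G" "?g2 \<in> carrier G" "?g2 \<in> fst ` \<A>" "e1 \<in> carrier G" "e2 \<in> carrier G"
        using c e1 e2 fst B(2) by auto
      have "tr e1 e2 (c (e1 \<otimes> t)) (c (e2 \<otimes> t)) \<notin> K"
      proof
        assume k: "tr e1 e2 (c (e1 \<otimes> t)) (c (e2 \<otimes> t)) \<in> K"
        have "tr e1 e2 (c (e1 \<otimes> t)) (c (e2 \<otimes> t)) \<otimes> (?g1 \<otimes> e1) = ?g2 \<otimes> e2"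
          unfolding tr_def using g by (intro mult_inv_cancel) auto
        then have "inv ?g2 \<otimes> (tr e1 e2 (c (e1 \<otimes> t)) (c (e2 \<otimes> t)) \<otimes> (?g1 \<otimes> e1)) = e2"
          using g by (simp add: m_assoc[symmetric])
        then have "e2 \<in> ?bad" using k g(3) by force
        then show False using e2(4) by simp
      qed
      then show "\<exists>e. ?P t (fst e) (snd e)" using e1 e2 by (intro exI[of _ "(e1, e2)"]) auto
    qed
    from bchoice[OF this] obtain e where e: "\<forall>t\<in>T. ?P t (fst (e t)) (snd (e t))" ..
    define e1 e2 where "e1 t = fst (e t)" and "e2 t = snd (e t)" for t
    define s1 s2 where "s1 t = e1 t \<otimes> t" and "s2 t = e2 t \<otimes> t" for t
    have P: "?P t (e1 t) (e2 t)" if "t \<in> T" for t using e that by (simp add: e1_def e2_def)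
    have s12: "s1 t \<in> J" "s2 t \<in> J" if "t \<in> T" for t using P[OF that] by (simp_all add: s1_def s2_def)
    \<comment> \<open>Labels at all merged positions are to be prescribed independently, so these
      must be distinct: separation of \<open>T\<close> handles different \<open>t\<close>, and
      \<open>e1 t \<noteq> e2 t\<close> handles a single one.\<close>
    have s_ne: "s1 t \<noteq> s2 t'" if "t \<in> T" "t' \<in> T" for t t'
    proof
      assume eq: "s1 t = s2 t'"
      then have "t = t'" using sep[of t t' "e1 t" "e2 t'"] that P by (auto simp: s1_def s2_def)
      then show False using eq P[OF that(1)] that Tc B(2) by (metis right_cancel s1_def s2_def subsetD)
    qed
    have s_inj: "inj_on s1 T" "inj_on s2 T"
      unfolding inj_on_def s1_def s2_def using sep P by metis+
    have "independent V' \<B> T" unfolding independent_def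
    proof (intro exI[of _ "\<lambda>t. mk (e1 t) (e2 t) (c (s1 t)) (c (s2 t))"] conjI ballI allI impI)
      fix t assume "t \<in> T"
      then show "mk (e1 t) (e2 t) (c (s1 t)) (c (s2 t)) \<in> \<B>"
        unfolding \<B>_def using P[of t] c[OF s12(1)] c[OF s12(2)]
        by (intro CollectI exI[of _ "e1 t"] exI[of _ "e2 t"] exI[of _ "c (s1 t)"] exI[of _ "c (s2 t)"])
          (simp add: s1_def s2_def)
    next
      fix \<omega> assume \<omega>: "\<forall>t\<in>T. \<omega> t \<in> V'"
      \<comment> \<open>The first position of each pair gets the label \<open>u\<close>, the second
        \<open>w\<close>; the remaining positions get a default label, which only has to lie in
        \<open>V\<close>.\<close>
      define \<sigma> where "\<sigma> s = (if s \<in> s1 ` T then u (\<omega> (inv_into T s1 s))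
        else if s \<in> s2 ` T then w (\<omega> (inv_into T s2 s)) else u (\<omega> t0))" for s
      have "\<sigma> s \<in> V" for s
        using \<omega> uw \<open>t0 \<in> T\<close> by (auto simp: \<sigma>_def inv_into_into)
      then obtain x where x: "x \<in> E" "\<forall>s\<in>J. \<phi> (fst (c s) \<otimes> s) x \<in> snd (c s) (\<sigma> s)" using cx by blast
      show "\<exists>x\<in>E. \<forall>t\<in>T. \<phi> (fst (mk (e1 t) (e2 t) (c (s1 t)) (c (s2 t))) \<otimes> t) x
          \<in> snd (mk (e1 t) (e2 t) (c (s1 t)) (c (s2 t))) (\<omega> t)"
      proof (intro bexI[of _ x] ballI)
        fix t assume t: "t \<in> T"
        let ?a1 = "c (s1 t)" and ?a2 = "c (s2 t)"
        have car: "fst ?a1 \<in> carrier G" "fst ?a2 \<in> carrier G" "e1 t \<in> carrier G" "e2 t \<in> carrier G" "t \<in> carrier G"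
          using c[OF s12(1)[OF t]] c[OF s12(2)[OF t]] fst P[OF t] B(2) Tc t by auto
        have "\<sigma> (s1 t) = u (\<omega> t)" using t s_inj by (simp add: \<sigma>_def)
        then have x1: "\<phi> ((fst ?a1 \<otimes> e1 t) \<otimes> t) x \<in> snd ?a1 (u (\<omega> t))"
          using x(2) s12(1)[OF t] car by (fastforce simp: s1_def m_assoc)
        have "s2 t \<notin> s1 ` T" using s_ne t by fastforce
        then have "\<sigma> (s2 t) = w (\<omega> t)" using t s_inj by (simp add: \<sigma>_def)
        then have x2: "\<phi> (fst ?a2 \<otimes> (e2 t \<otimes> t)) x \<in> snd ?a2 (w (\<omega> t))"
          using x(2) s12(2)[OF t] by (fastforce simp: s2_def)
        have "tr (e1 t) (e2 t) ?a1 ?a2 \<otimes> ((fst ?a1 \<otimes> e1 t) \<otimes> t) = fst ?a2 \<otimes> (e2 t \<otimes> t)"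
          unfolding tr_def using car mult_inv_cancel[of "fst ?a2 \<otimes> e2 t" "fst ?a1 \<otimes> e1 t"]
          by (metis m_assoc m_closed inv_closed)
        then have "\<phi> (tr (e1 t) (e2 t) ?a1 ?a2) (\<phi> ((fst ?a1 \<otimes> e1 t) \<otimes> t) x) = \<phi> (fst ?a2 \<otimes> (e2 t \<otimes> t)) x"
          using composition_rule[OF x(1), of "tr (e1 t) (e2 t) ?a1 ?a2" "(fst ?a1 \<otimes> e1 t) \<otimes> t"] car
          by (simp add: tr_def)
        then show "\<phi> (fst (mk (e1 t) (e2 t) ?a1 ?a2) \<otimes> t) x \<in> snd (mk (e1 t) (e2 t) ?a1 ?a2) (\<omega> t)"
          using x1 x2 x(1) car by (auto simp: mk_def action_closed)
      qed (rule x(1))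
    qed
    then show ?thesis using T by blast
  qed
  then have "positive_density V' \<B>" unfolding positive_density_def using B(3)
    by (intro exI[of _ q] conjI allI impI)
  then show ?thesis by (rule that[OF 1 2 _ 3])
qed

text \<open>\<open>positive_density_split\<close> cuts the set of one label, so it is iterated over
  \<open>W\<close>. A label not yet treated still has its original set, hence each set is cut
  once.\<close>

lemma positive_density_refine:
  fixes V W :: "'v set"
  assumes V: "finite V" "card V \<ge> 2" and D: "finite \<D>" "\<D> \<noteq> {}" "E \<subseteq> \<Union>\<D>"
    and A: "finite \<A>" "fst ` \<A> \<subseteq> carrier G" "positive_density V \<A>"
    and "W \<subseteq> V"
  shows "\<exists>\<B>. finite \<B> \<and> fst ` \<B> \<subseteq> carrier G \<and> positive_density V \<B> \<and>
    (\<forall>C'\<in>snd ` \<B>. \<exists>C\<in>snd ` \<A>. \<forall>v. if v \<in> W then \<exists>D\<in>\<D>. C' v = C v \<inter> D else C' v = C v)"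
  using finite_subset[OF \<open>W \<subseteq> V\<close> V(1)] \<open>W \<subseteq> V\<close>
proof (induction W rule: finite_induct)
  case empty
  show ?case using A by (intro exI[of _ \<A>]) auto
next
  case (insert v0 W)
  then obtain \<B> where B: "finite \<B>" "fst ` \<B> \<subseteq> carrier G" "positive_density V \<B>"
    and BC: "\<And>C'. C' \<in> snd ` \<B> \<Longrightarrow> \<exists>C\<in>snd ` \<A>. \<forall>v. if v \<in> W then \<exists>D\<in>\<D>. C' v = C v \<inter> D else C' v = C v"
    by (smt (verit) insert_subset)
  let ?B = "{(g, C(v0 := C v0 \<inter> D)) | g C D. (g, C) \<in> \<B> \<and> D \<in> \<D>}"
  have "?B \<subseteq> (\<lambda>((g, C), D). (g, C(v0 := C v0 \<inter> D))) ` (\<B> \<times> \<D>)" by force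
  then have "finite ?B" by (rule finite_subset) (use B D in auto)
  moreover have "fst ` ?B \<subseteq> carrier G" using B(2) by force
  moreover have "positive_density V ?B"
    by (rule positive_density_split) (use V D B insert.prems in auto)
  moreover have "\<exists>C\<in>snd ` \<A>. \<forall>v. if v \<in> insert v0 W then \<exists>D\<in>\<D>. C'' v = C v \<inter> D else C'' v = C v"
    if "C'' \<in> snd ` ?B" for C''
  proof -
    from that obtain g C' D where *: "(g, C') \<in> \<B>" "D \<in> \<D>" "C'' = C'(v0 := C' v0 \<inter> D)" by auto
    then have "C' \<in> snd ` \<B>" by force
    then obtain C where C: "C \<in> snd ` \<A>" "\<forall>v. if v \<in> W then \<exists>D\<in>\<D>. C' v = C v \<inter> D else C' v = C v"
      using BC by blast
    have "C' v0 = C v0" using C(2) insert.hyps by auto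
    then show ?thesis using C * by (intro bexI[of _ C]) auto
  qed
  ultimately show ?case by (intro exI[of _ ?B]) blast
qed

end

section \<open>The Cantor scheme\<close>

text \<open>If every \<open>b\<close> failed at some stage, none would survive to the maximum of
  these finitely many stages.\<close>

lemma finite_decreasing_choice:
  assumes "finite T" "\<And>k::nat. \<exists>b\<in>T. P k b" "\<And>k b. P (Suc k) b \<Longrightarrow> P k b"
  shows "\<exists>b\<in>T. \<forall>k. P k b"
proof (rule ccontr)
  assume "\<not> ?thesis"
  then obtain k where k: "\<And>b. b \<in> T \<Longrightarrow> \<not> P (k b) b" by metis
  have mono: "P j b" if "P i b" "j \<le> i" for i j b
    using that(2,1) by (induction rule: inc_induct) (auto intro: assms(3))
  obtain b where b: "b \<in> T" "P (Max (k ` T)) b" using assms(2) by blast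
  then have "k b \<le> Max (k ` T)" using assms(1) by simp
  then show False using mono[OF b(2)] k[OF b(1)] by blast
qed

text \<open>Koenig's lemma for finite levels in which every node has a parent. The path follows
  nodes with descendants at every depth; since the next level is finite, one child serves all
  depths.\<close>

lemma finite_levels_infinite_path:
  assumes fin: "\<And>n. finite (S n)" and ne: "\<And>n. S n \<noteq> {}"
    and parent: "\<And>n b. b \<in> S (Suc n) \<Longrightarrow> \<exists>a\<in>S n. R n a b"
  obtains f where "\<And>n::nat. f n \<in> S n" "\<And>n. R n (f n) (f (Suc n))"
proof -
  \<comment> \<open>\<open>desc k n a\<close> says that \<open>a\<close> lies on level
    \<open>n\<close> and starts a chain of \<open>k\<close> further nodes.\<close>
  define desc where "desc = rec_nat (\<lambda>n a. a \<in> S n)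
    (\<lambda>_ D n a. a \<in> S n \<and> (\<exists>b. R n a b \<and> D (Suc n) b))"
  have d0: "desc 0 n a \<longleftrightarrow> a \<in> S n"
    and dS: "desc (Suc k) n a \<longleftrightarrow> a \<in> S n \<and> (\<exists>b. R n a b \<and> desc k (Suc n) b)" for k n a
    by (simp_all add: desc_def)
  have dS': "a \<in> S n" if "desc k n a" for k n a using that by (cases k) (auto simp: d0 dS)
  have ex: "\<exists>a\<in>S n. desc k n a" for k n
  proof (induction k arbitrary: n)
    case 0
    then show ?case using ne[of n] by (auto simp: d0)
  next
    case (Suc k)
    then obtain b where "b \<in> S (Suc n)" "desc k (Suc n) b" by blast
    then show ?case using parent[of b n] by (auto simp: dS)
  qed
  have anti: "desc k n a" if "desc (Suc k) n a" for k n a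
    using that by (induction k arbitrary: n a) (auto simp: d0 dS)
  have "\<exists>a. \<forall>k. desc k 0 a"
    using finite_decreasing_choice[OF fin[of 0] ex[of 0]] anti by blast
  moreover have "\<exists>b. (\<forall>k. desc k (Suc n) b) \<and> R n a b" if "\<forall>k. desc k n a" for n a
  proof -
    have "\<exists>b\<in>{b\<in>S (Suc n). R n a b}. \<forall>k. desc k (Suc n) b"
    proof (rule finite_decreasing_choice)
      show "\<exists>b\<in>{b\<in>S (Suc n). R n a b}. desc k (Suc n) b" for k
        using that[rule_format, of "Suc k"] dS' by (auto simp: dS)
    qed (use fin anti in auto)
    then show ?thesis by blast
  qed
  ultimately obtain f where "\<And>n. \<forall>k. desc k n (f n)" "\<And>n. R n (f n) (f (Suc n))"
    using dependent_nat_choice[of "\<lambda>n a. \<forall>k. desc k n a" "\<lambda>n a b. R n a b"] by metis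
  then show ?thesis using dS' by (intro that[of f]) blast+
qed

section \<open>Stages of the scheme and its branches\<close>

locale compact_metric_action = group_action G E \<phi> + Metric_space E d
  for G (structure) and E :: "'c set" and \<phi> and d +
  assumes continuous: "\<And>s. s \<in> carrier G \<Longrightarrow> continuous_map mtopology mtopology (\<phi> s)"
    and compact: "compact_space mtopology"
    and infinite: "infinite (carrier G)"
begin

text \<open>The length is \<open>n + 1\<close>, so level 0 already has the two labels
  \<open>[False]\<close> and \<open>[True]\<close>.\<close>

definition words :: "nat \<Rightarrow> bool list set" where
  "words n = {v. length v = Suc n}"

text \<open>Separation is required only for different first letters, with the same
  \<open>\<delta>\<close> on all levels: it is inherited by smaller sets, and joins can show any
  later letter through a first letter at another time.\<close>

definition stage :: "nat \<Rightarrow> real \<Rightarrow> ('a \<times> (bool list \<Rightarrow> 'c set)) set \<Rightarrow> bool" where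
  "stage n \<delta> \<A> \<longleftrightarrow> finite \<A> \<and> fst ` \<A> \<subseteq> carrier G \<and> positive_density (words n) \<A> \<and>
     (\<forall>C\<in>snd ` \<A>. (\<forall>v. closedin mtopology (C v)) \<and>
        (\<forall>v\<in>words n. \<forall>v'\<in>words n. hd v \<noteq> hd v' \<longrightarrow> (\<forall>x\<in>C v. \<forall>y\<in>C v'. \<delta> \<le> d x y)))"

text \<open>\<open>butlast v\<close> is the parent word and \<open>last v\<close> the letter just
  added. All sets are jointly small at time \<open>t\<close>, and the new letter is visible at time
  \<open>s\<close>. Avoiding ever larger finite \<open>K\<close> will send these times to
  infinity.\<close>

definition child :: "nat \<Rightarrow> real \<Rightarrow> real \<Rightarrow> 'a set \<Rightarrow> (bool list \<Rightarrow> 'c set) \<Rightarrow> (bool list \<Rightarrow> 'c set) \<Rightarrow> bool" where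
  "child n \<delta> r K C C' \<longleftrightarrow> (\<forall>v\<in>words (Suc n). C' v \<subseteq> C (butlast v)) \<and>
     (\<exists>t\<in>carrier G - K. \<forall>v\<in>words (Suc n). \<forall>v'\<in>words (Suc n). \<forall>x\<in>C' v. \<forall>y\<in>C' v'. d (\<phi> t x) (\<phi> t y) < r) \<and>
     (\<exists>s\<in>carrier G - K. \<forall>v\<in>words (Suc n). \<forall>v'\<in>words (Suc n). last v \<noteq> last v' \<longrightarrow>
        (\<forall>x\<in>C' v. \<forall>y\<in>C' v'. \<delta> \<le> d (\<phi> s x) (\<phi> s y)))"

lemma words_eq: "words n = {v. set v \<subseteq> UNIV \<and> length v = Suc n}"
  by (auto simp: words_def)

lemma finite_words: "finite (words n)"
  unfolding words_eq by (rule finite_lists_length_eq) simp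

lemma card_words: "card (words n) = 2 ^ Suc n"
  unfolding words_eq by (subst card_lists_length_eq) auto

lemma closedin_translate:
  assumes "s \<in> carrier G" "closedin mtopology A"
  shows "closedin mtopology {x\<in>E. \<phi> s x \<in> A}"
  using closedin_continuous_map_preimage[OF continuous[OF assms(1)] assms(2)] by simp

lemma small_closed_cover:
  assumes "r > 0"
  obtains \<D> where "finite \<D>" "\<D> \<noteq> {}" "E \<subseteq> \<Union>\<D>" "\<And>D. D \<in> \<D> \<Longrightarrow> closedin mtopology D"
    "\<And>D x y. D \<in> \<D> \<Longrightarrow> x \<in> D \<Longrightarrow> y \<in> D \<Longrightarrow> d x y < r"
proof -
  have "mtotally_bounded E"
    using compact compact_space_eq_mcomplete_mtotally_bounded by blast
  then obtain K where K: "finite K" "K \<subseteq> E" "E \<subseteq> (\<Union>x\<in>K. mball x (r/3))"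
    using assms unfolding mtotally_bounded_def by (metis divide_pos_pos zero_less_numeral)
  have "d x y < r" if "a \<in> K" "x \<in> mcball a (r/3)" "y \<in> mcball a (r/3)" for a x y
  proof -
    have "d x y \<le> d a x + d a y" using that triangle'[of a x y] triangle[of x a y] commute[of x a]
      by (simp add: in_mcball)
    then show ?thesis using that assms by (simp add: in_mcball)
  qed
  moreover have "E \<subseteq> (\<Union>a\<in>K. mcball a (r/3))"
    using K(3) mball_subset_mcball by (meson SUP_mono order_trans)
  \<comment> \<open>The empty set is added so that \<open>\<D>\<close> is nonempty even if
    \<open>E\<close> is empty.\<close>
  ultimately show ?thesis using K(1)
    by (intro that[of "insert {} ((\<lambda>a. mcball a (r/3)) ` K)"]) (auto simp del: in_mcball)
qed

text \<open>Cut all sets into small pieces, join with one small set to get the time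
  \<open>t\<close>, then join with the separated sets to get the time \<open>s\<close>. Each
  operation only shrinks the sets attached to given words, so what was gained before
  survives.\<close>

lemma stage_step:
  assumes st: "stage n \<delta> \<A>" and K: "finite K" and "r > 0"
  shows "\<exists>\<B>. stage (Suc n) \<delta> \<B> \<and> (\<forall>C'\<in>snd ` \<B>. \<exists>C\<in>snd ` \<A>. child n \<delta> r K C C')"
proof -
  have A: "finite \<A>" "fst ` \<A> \<subseteq> carrier G" "positive_density (words n) \<A>"
    and clA: "\<And>C v. C \<in> snd ` \<A> \<Longrightarrow> closedin mtopology (C v)"
    and sepA: "\<And>C v v' x y. C \<in> snd ` \<A> \<Longrightarrow> v \<in> words n \<Longrightarrow> v' \<in> words n \<Longrightarrow> hd v \<noteq> hd v' \<Longrightarrow>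
      x \<in> C v \<Longrightarrow> y \<in> C v' \<Longrightarrow> \<delta> \<le> d x y"
    using st by (auto simp: stage_def)
  obtain \<D> where D: "finite \<D>" "\<D> \<noteq> {}" "E \<subseteq> \<Union>\<D>" and clD: "\<And>D. D \<in> \<D> \<Longrightarrow> closedin mtopology D"
    and small: "\<And>D x y. D \<in> \<D> \<Longrightarrow> x \<in> D \<Longrightarrow> y \<in> D \<Longrightarrow> d x y < r"
    by (rule small_closed_cover[OF \<open>r > 0\<close>]) blast
  have "card (words n) \<ge> 2" by (simp add: card_words)
  from positive_density_refine[OF finite_words this D A subset_refl] obtain \<A>1 where
    A1: "finite \<A>1" "fst ` \<A>1 \<subseteq> carrier G" "positive_density (words n) \<A>1" and
    A1': "\<And>C'. C' \<in> snd ` \<A>1 \<Longrightarrow> \<exists>C\<in>snd ` \<A>. \<forall>v. if v \<in> words n then \<exists>D\<in>\<D>. C' v = C v \<inter> D else C' v = C v"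
    by blast
  define a where "a = replicate (Suc n) False"
  have a: "a \<in> words n" by (simp add: a_def words_def)
  \<comment> \<open>The second label is constantly \<open>a\<close>, so at time \<open>t\<close>
    every set of the colour is carried into the same small set \<open>C2 a\<close>.\<close>
  obtain \<A>2 where A2: "finite \<A>2" "fst ` \<A>2 \<subseteq> carrier G" "positive_density (words n) \<A>2"
    and A2': "\<And>C'. C' \<in> snd ` \<A>2 \<Longrightarrow> \<exists>C1\<in>snd ` \<A>1. \<exists>C2\<in>snd ` \<A>1. \<exists>t\<in>carrier G - K.
       C' = (\<lambda>v. C1 v \<inter> {x\<in>E. \<phi> t x \<in> C2 a})"
    by (rule positive_density_join_translate[OF A1 infinite K, of "words n" "\<lambda>v. v" "\<lambda>_. a"]) (use a in auto)
  \<comment> \<open>Words grow here: \<open>butlast v\<close> selects the old set, and the new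
    letter selects the set visited at time \<open>s\<close>. It is placed first, where
    \<open>\<delta>\<close>-separation applies, and padded to a word of level
    \<open>n\<close>.\<close>
  obtain \<A>3 where A3: "finite \<A>3" "fst ` \<A>3 \<subseteq> carrier G" "positive_density (words (Suc n)) \<A>3"
    and A3': "\<And>C'. C' \<in> snd ` \<A>3 \<Longrightarrow> \<exists>C1\<in>snd ` \<A>2. \<exists>C2\<in>snd ` \<A>2. \<exists>s\<in>carrier G - K.
       C' = (\<lambda>v. C1 (butlast v) \<inter> {x\<in>E. \<phi> s x \<in> C2 (last v # replicate n False)})"
    by (rule positive_density_join_translate[OF A2 infinite K, of "words (Suc n)" butlast
        "\<lambda>v. last v # replicate n False"]) (auto simp: words_def)
  have cl1: "closedin mtopology (C v)" if C: "C \<in> snd ` \<A>1" for C v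
  proof -
    from A1'[OF C] obtain B where B: "B \<in> snd ` \<A>"
      "\<forall>v. if v \<in> words n then \<exists>D\<in>\<D>. C v = B v \<inter> D else C v = B v" by blast
    show ?thesis
    proof (cases "v \<in> words n")
      case True
      then obtain D where "D \<in> \<D>" "C v = B v \<inter> D" using B(2)[THEN spec, of v] by auto
      then show ?thesis using clA[OF B(1)] clD by (simp add: closedin_Int)
    next
      case False
      then have "C v = B v" using B(2)[THEN spec, of v] by simp
      then show ?thesis using clA[OF B(1)] by simp
    qed
  qed
  have sub1: "\<exists>C\<in>snd ` \<A>. \<forall>v. C' v \<subseteq> C v" if C: "C' \<in> snd ` \<A>1" for C'
  proof -
    from A1'[OF C] obtain B where B: "B \<in> snd ` \<A>"
      "\<forall>v. if v \<in> words n then \<exists>D\<in>\<D>. C' v = B v \<inter> D else C' v = B v" by blast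
    have "C' v \<subseteq> B v" for v using B(2)[rule_format, of v] by (auto split: if_splits)
    then show ?thesis using B(1) by blast
  qed
  have small1: "d x y < r" if C: "C \<in> snd ` \<A>1" and "x \<in> C a" "y \<in> C a" for C x y
  proof -
    from A1'[OF C] obtain B where B: "\<forall>v. if v \<in> words n then \<exists>D\<in>\<D>. C v = B v \<inter> D else C v = B v" by blast
    obtain D where "D \<in> \<D>" "C a = B a \<inter> D" using a B[THEN spec, of a] by auto
    then show ?thesis using small that(2,3) by auto
  qed
  have cl2: "closedin mtopology (C v)" if C: "C \<in> snd ` \<A>2" for C v
    using A2'[OF C] by (elim bexE) (simp add: closedin_Int cl1 closedin_translate)
  have sub2: "\<exists>C\<in>snd ` \<A>. \<forall>v. C' v \<subseteq> C v" if C: "C' \<in> snd ` \<A>2" for C'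
  proof -
    from A2'[OF C] obtain C1 where "C1 \<in> snd ` \<A>1" "\<forall>v. C' v \<subseteq> C1 v" by fastforce
    moreover from sub1[OF this(1)] obtain C where "C \<in> snd ` \<A>" "\<forall>v. C1 v \<subseteq> C v" by blast
    ultimately show ?thesis by (intro bexI[of _ C]) (auto intro: subset_trans)
  qed
  have sep2: "\<delta> \<le> d x y" if "C \<in> snd ` \<A>2" "v \<in> words n" "v' \<in> words n" "hd v \<noteq> hd v'"
      "x \<in> C v" "y \<in> C v'" for C v v' x y
  proof -
    from sub2[OF that(1)] obtain B where "B \<in> snd ` \<A>" "\<forall>v. C v \<subseteq> B v" by blast
    then show ?thesis using sepA[of B v v' x y] that by auto
  qed
  have cl3: "closedin mtopology (C v)" if C: "C \<in> snd ` \<A>3" for C v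
    using A3'[OF C] by (elim bexE) (simp add: closedin_Int cl2 closedin_translate)
  have bl: "butlast v \<in> words n" "hd (butlast v) = hd v"
    if "v \<in> words (Suc n)" for v
    using that by (auto simp: words_def length_Suc_conv)
  have rep: "b # replicate n False \<in> words n" for b by (simp add: words_def)
  have "stage (Suc n) \<delta> \<A>3"
    unfolding stage_def
  proof (intro conjI ballI allI impI A3)
    fix C v v' x y assume C: "C \<in> snd ` \<A>3" and v: "v \<in> words (Suc n)" "v' \<in> words (Suc n)" "hd v \<noteq> hd v'"
      and x: "x \<in> C v" "y \<in> C v'"
    from A3'[OF C] obtain C1 where "C1 \<in> snd ` \<A>2" "\<forall>v. C v \<subseteq> C1 (butlast v)" by fastforce
    then show "\<delta> \<le> d x y" using sep2[of C1 "butlast v" "butlast v'" x y] bl[OF v(1)] bl[OF v(2)] v(3) x by auto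
  qed (rule cl3)
  moreover have "\<exists>C\<in>snd ` \<A>. child n \<delta> r K C C'" if C': "C' \<in> snd ` \<A>3" for C'
  proof -
    from A3'[OF C'] obtain C1 C2 s where C1: "C1 \<in> snd ` \<A>2" and C2: "C2 \<in> snd ` \<A>2" and s: "s \<in> carrier G - K"
      and eq: "C' = (\<lambda>v. C1 (butlast v) \<inter> {x\<in>E. \<phi> s x \<in> C2 (last v # replicate n False)})" by blast
    from A2'[OF C1] obtain B1 B2 t where B2: "B2 \<in> snd ` \<A>1" and t: "t \<in> carrier G - K"
      and eq1: "C1 = (\<lambda>v. B1 v \<inter> {x\<in>E. \<phi> t x \<in> B2 a})" by blast
    from sub2[OF C1] obtain C where C: "C \<in> snd ` \<A>" "\<forall>v. C1 v \<subseteq> C v" by blast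
    have "child n \<delta> r K C C'" unfolding child_def
    proof (intro conjI)
      show "\<forall>v\<in>words (Suc n). C' v \<subseteq> C (butlast v)" using C(2) by (auto simp: eq)
      show "\<exists>t\<in>carrier G - K. \<forall>v\<in>words (Suc n). \<forall>v'\<in>words (Suc n). \<forall>x\<in>C' v. \<forall>y\<in>C' v'. d (\<phi> t x) (\<phi> t y) < r"
        using small1[OF B2] by (intro bexI[OF _ t]) (simp add: eq eq1)
      show "\<exists>s\<in>carrier G - K. \<forall>v\<in>words (Suc n). \<forall>v'\<in>words (Suc n). last v \<noteq> last v' \<longrightarrow>
          (\<forall>x\<in>C' v. \<forall>y\<in>C' v'. \<delta> \<le> d (\<phi> s x) (\<phi> s y))"
      proof (intro bexI[OF _ s] ballI impI)
        fix v v' x y assume "v \<in> words (Suc n)" "v' \<in> words (Suc n)" "last v \<noteq> last v'" "x \<in> C' v" "y \<in> C' v'"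
        then show "\<delta> \<le> d (\<phi> s x) (\<phi> s y)"
          using rep by (intro sep2[OF C2, of "last v # replicate n False" "last v' # replicate n False"]) (auto simp: eq)
      qed
    qed
    then show ?thesis using C(1) by blast
  qed
  ultimately show ?thesis by blast
qed

text \<open>Density on a singleton \<open>{s}\<close> forces \<open>J = {s}\<close>, so the colour
  at \<open>s\<close> realizes every label.\<close>

lemma positive_density_imp_nonempty:
  assumes "positive_density V \<A>"
  obtains a where "a \<in> \<A>" "\<And>v. v \<in> V \<Longrightarrow> snd a v \<noteq> {}"
proof -
  obtain s where s: "s \<in> carrier G" using infinite by (metis finite.emptyI ex_in_conv)
  obtain q :: real where "q > 0" "\<And>F. finite F \<Longrightarrow> F \<noteq> {} \<Longrightarrow> F \<subseteq> carrier G \<Longrightarrow>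
     (\<exists>J\<subseteq>F. q * card F \<le> real (card J) \<and> independent V \<A> J)"
    using assms unfolding positive_density_def by blast
  from this(2)[of "{s}"] s obtain J where J: "J \<subseteq> {s}" "q \<le> card J" "independent V \<A> J" by auto
  have "J = {s}" using J \<open>q > 0\<close> by (cases "J = {}") auto
  then obtain c where "c s \<in> \<A>"
      "\<forall>\<omega>. \<omega> s \<in> V \<longrightarrow> (\<exists>x\<in>E. \<phi> (fst (c s) \<otimes> s) x \<in> snd (c s) (\<omega> s))"
    using J(3) unfolding independent_def by auto
  then show ?thesis by (intro that[of "c s"]) (auto dest: spec[of _ "\<lambda>_. _"])
qed

text \<open>The stages only say that each colour has some parent, so Koenig's lemma picks one
  coherent sequence of colours; compactness then gives a point on every branch. The times at each
  level serve all pairs of branches at once. The letter compared is \<open>\<omega> (Suc n)\<close>,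
  the one added between levels \<open>n\<close> and \<open>n + 1\<close>.\<close>

lemma scrambled_points:
  fixes K :: "nat \<Rightarrow> 'a set"
  assumes st: "stage 0 \<delta> \<A>" and K: "\<And>n. finite (K n)"
  shows "\<exists>x :: (nat \<Rightarrow> bool) \<Rightarrow> 'c. (\<forall>\<omega>. x \<omega> \<in> E) \<and>
    (\<forall>n. \<exists>t\<in>carrier G - K n. \<forall>\<omega> \<omega>'. d (\<phi> t (x \<omega>)) (\<phi> t (x \<omega>')) < inverse (Suc n)) \<and>
    (\<forall>n. \<exists>s\<in>carrier G - K n. \<forall>\<omega> \<omega>'. \<omega> (Suc n) \<noteq> \<omega>' (Suc n) \<longrightarrow> \<delta> \<le> d (\<phi> s (x \<omega>)) (\<phi> s (x \<omega>')))"
proof -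
  let ?Q = "\<lambda>n \<A>' \<B>. \<forall>C'\<in>snd ` \<B>. \<exists>C\<in>snd ` \<A>'. child n \<delta> (inverse (Suc n)) (K n) C C'"
  have "\<exists>\<B>. \<forall>n. stage n \<delta> (\<B> n) \<and> ?Q n (\<B> n) (\<B> (Suc n))"
  proof (rule dependent_nat_choice)
    show "\<exists>\<A>'. stage 0 \<delta> \<A>'" using st by blast
    show "\<exists>\<B>. stage (Suc n) \<delta> \<B> \<and> ?Q n \<A>' \<B>" if "stage n \<delta> \<A>'" for n \<A>'
      by (rule stage_step[OF that K]) simp
  qed
  then obtain \<B> where "\<forall>n. stage n \<delta> (\<B> n) \<and> ?Q n (\<B> n) (\<B> (Suc n))" ..
  then have B: "\<And>n. stage n \<delta> (\<B> n)" and
    child: "\<And>n C'. C' \<in> snd ` \<B> (Suc n) \<Longrightarrow> \<exists>C\<in>snd ` \<B> n. child n \<delta> (inverse (Suc n)) (K n) C C'"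
    by blast+
  \<comment> \<open>Nonemptiness of all sets passes to the parent, because
    \<open>C' (v @ [False]) \<subseteq> C v\<close>.\<close>
  define S where "S n = {C\<in>snd ` \<B> n. \<forall>v\<in>words n. C v \<noteq> {}}" for n
  obtain C where CS: "\<And>n. C n \<in> S n" and Cc: "\<And>n. child n \<delta> (inverse (Suc n)) (K n) (C n) (C (Suc n))"
  proof (rule finite_levels_infinite_path[of S "\<lambda>n. child n \<delta> (inverse (Suc n)) (K n)"])
    show "finite (S n)" for n using B[of n] by (simp add: S_def stage_def)
    show "S n \<noteq> {}" for n
    proof -
      have "positive_density (words n) (\<B> n)" using B[of n] by (simp add: stage_def)
      then obtain a where "a \<in> \<B> n" "\<And>v. v \<in> words n \<Longrightarrow> snd a v \<noteq> {}"
        by (rule positive_density_imp_nonempty) blast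
      then show ?thesis by (auto simp: S_def)
    qed
    show "\<exists>C\<in>S n. child n \<delta> (inverse (Suc n)) (K n) C C'" if C': "C' \<in> S (Suc n)" for n C'
    proof -
      obtain C where C: "C \<in> snd ` \<B> n" "child n \<delta> (inverse (Suc n)) (K n) C C'"
        using child[of C' n] C' by (simp only: S_def mem_Collect_eq) blast
      have "C v \<noteq> {}" if "v \<in> words n" for v
      proof -
        have "v @ [False] \<in> words (Suc n)" using that by (simp add: words_def)
        moreover from this have "C' (v @ [False]) \<noteq> {}" using C' by (simp add: S_def)
        moreover have "\<forall>v\<in>words (Suc n). C' v \<subseteq> C (butlast v)" using C(2) by (simp add: child_def)
        ultimately have "C' (v @ [False]) \<noteq> {}" "C' (v @ [False]) \<subseteq> C v" by (simp, force)
        then show ?thesis by auto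
      qed
      then show ?thesis using C by (auto simp: S_def)
    qed
  qed blast
  define pre :: "(nat \<Rightarrow> bool) \<Rightarrow> nat \<Rightarrow> bool list" where "pre \<omega> n = map \<omega> [0..<Suc n]" for \<omega> n
  have pre: "pre \<omega> n \<in> words n" "butlast (pre \<omega> (Suc n)) = pre \<omega> n" "last (pre \<omega> (Suc n)) = \<omega> (Suc n)" for \<omega> n
    by (simp_all add: pre_def words_def butlast_append)
  have "(\<Inter>n. C n (pre \<omega> n)) \<noteq> {}" for \<omega>
  proof (rule compact_space_imp_nest[OF compact])
    show "closedin mtopology (C n (pre \<omega> n))" for n
      using B[of n] CS[of n] by (auto simp: S_def stage_def)
    show "C n (pre \<omega> n) \<noteq> {}" for n using CS[of n] pre(1) by (auto simp: S_def)
    show "decseq (\<lambda>n. C n (pre \<omega> n))"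
    proof (rule decseq_SucI)
      show "C (Suc n) (pre \<omega> (Suc n)) \<subseteq> C n (pre \<omega> n)" for n
        using Cc[of n] pre(1)[of \<omega> "Suc n"] pre(2)[of \<omega> n] unfolding child_def by metis
    qed
  qed
  then have "\<exists>x. \<forall>n. x \<in> C n (pre \<omega> n)" for \<omega> by blast
  then obtain x where x: "\<And>\<omega> n. x \<omega> \<in> C n (pre \<omega> n)" by metis
  show ?thesis
  proof (intro exI[of _ x] conjI allI)
    show "x \<omega> \<in> E" for \<omega>
    proof -
      have "closedin mtopology (C 0 (pre \<omega> 0))" using B[of 0] CS[of 0] by (auto simp: S_def stage_def)
      then show ?thesis using x[of \<omega> 0] closedin_subset by fastforce
    qed
    show "\<exists>t\<in>carrier G - K n. \<forall>\<omega> \<omega>'. d (\<phi> t (x \<omega>)) (\<phi> t (x \<omega>')) < inverse (Suc n)" for n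
    proof -
      from Cc[of n] obtain t where t: "t \<in> carrier G - K n" "\<forall>v\<in>words (Suc n). \<forall>v'\<in>words (Suc n).
          \<forall>x\<in>C (Suc n) v. \<forall>y\<in>C (Suc n) v'. d (\<phi> t x) (\<phi> t y) < inverse (Suc n)"
        unfolding child_def by blast
      have "d (\<phi> t (x \<omega>)) (\<phi> t (x \<omega>')) < inverse (Suc n)" for \<omega> \<omega>'
        using t(2)[THEN bspec, OF pre(1)[of \<omega>], THEN bspec, OF pre(1)[of \<omega>']] x by simp
      then show ?thesis using t(1) by blast
    qed
    show "\<exists>s\<in>carrier G - K n. \<forall>\<omega> \<omega>'. \<omega> (Suc n) \<noteq> \<omega>' (Suc n) \<longrightarrow> \<delta> \<le> d (\<phi> s (x \<omega>)) (\<phi> s (x \<omega>'))" for n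
    proof -
      from Cc[of n] obtain s where s: "s \<in> carrier G - K n" "\<And>v v' x y. v \<in> words (Suc n) \<Longrightarrow> v' \<in> words (Suc n) \<Longrightarrow>
        last v \<noteq> last v' \<Longrightarrow> x \<in> C (Suc n) v \<Longrightarrow> y \<in> C (Suc n) v' \<Longrightarrow> \<delta> \<le> d (\<phi> s x) (\<phi> s y)"
        unfolding child_def by blast
      show ?thesis
      proof (intro bexI[OF _ s(1)] allI impI)
        fix \<omega> \<omega>' :: "nat \<Rightarrow> bool" assume "\<omega> (Suc n) \<noteq> \<omega>' (Suc n)"
        then show "\<delta> \<le> d (\<phi> s (x \<omega>)) (\<phi> s (x \<omega>'))"
          using pre x by (intro s(2)[of "pre \<omega> (Suc n)" "pre \<omega>' (Suc n)"]) auto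
      qed
    qed
  qed
qed

end

section \<open>Entropy and chaos\<close>

lemma min_subcover_card_le:
  assumes "\<V> \<subseteq> \<W>" "finite \<V>" "\<Union>\<V> = topspace X"
  shows "min_subcover_card X \<W> \<le> card \<V>"
  unfolding min_subcover_card_def by (rule Least_le) (use assms in blast)

context compact_metric_action
begin

text \<open>Use binary coordinates \<open>(s, U)\<close> asking whether \<open>\<phi> s x\<close>
  lies well inside \<open>U\<close> or outside it. Patterns never contradicted by the points of
  \<open>E\<close> yield a subcover of the cover power, so many are needed and a large set of
  coordinates is shattered. Keeping one \<open>U\<close> for each \<open>s\<close> gives the
  colouring.\<close>

lemma stage_zero:
  fixes c :: real
  assumes U: "finite_open_cover mtopology \<U>" and "c > 0"
    and big: "\<And>F. finite F \<Longrightarrow> F \<noteq> {} \<Longrightarrow> F \<subseteq> carrier G \<Longrightarrow>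
      exp (c * card F) \<le> min_subcover_card mtopology (cover_power mtopology \<phi> F \<U>)"
  obtains \<delta> \<A> where "\<delta> > 0" "stage 0 \<delta> \<A>"
proof -
  interpret group G by (rule group_G)
  have finU: "finite \<U>" and opU: "\<And>U. U \<in> \<U> \<Longrightarrow> openin mtopology U" and covU: "\<Union>\<U> = E"
    using U by (auto simp: finite_open_cover_def)
  have "compactin mtopology E" using compact by (simp add: compact_space_def)
  then have "\<exists>\<epsilon>>0. \<forall>x\<in>E. \<exists>U\<in>\<U>. mball x \<epsilon> \<subseteq> U"
    by (rule lebesgue_number) (simp_all add: covU opU)
  then obtain \<epsilon> where "\<epsilon> > 0"
    and leb: "\<And>x. x \<in> E \<Longrightarrow> \<exists>U\<in>\<U>. mball x \<epsilon> \<subseteq> U" by blast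
  \<comment> \<open>\<open>\<epsilon>\<close> is a Lebesgue number, so the sets
    \<open>A U True\<close> still cover \<open>E\<close>, and each has distance at least
    \<open>\<epsilon>\<close> from \<open>A U False\<close>.\<close>
  define A where "A U b = (if b then {x\<in>E. \<forall>y\<in>E - U. \<epsilon> \<le> d x y} else E - U)" for U b
  have clA: "closedin mtopology (A U b)" if "U \<in> \<U>" for U b
  proof (cases b)
    case True
    have "E - A U True = (\<Union>y\<in>E - U. mball y \<epsilon>)"
      by (force simp: A_def not_le commute)
    then show ?thesis using True unfolding closedin_def
      by (auto simp: A_def intro!: openin_Union)
  next
    case False
    moreover have "E - (E - U) = U" using openin_subset[OF opU[OF that]] by auto
    ultimately show ?thesis using opU[OF that] by (simp add: A_def closedin_def)
  qed
  have sepA: "\<epsilon> \<le> d x y" if "x \<in> A U b" "y \<in> A U b'" "b \<noteq> b'" for x y U b b'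
    using that by (cases b; cases b') (auto simp: A_def commute)
  have covA: "\<exists>U\<in>\<U>. x \<in> A U True" if "x \<in> E" for x
  proof -
    from leb[OF that] obtain U where "U \<in> \<U>" "mball x \<epsilon> \<subseteq> U" by blast
    then show ?thesis using that by (intro bexI[of _ U]) (auto simp: A_def subset_iff not_le[symmetric])
  qed
  \<comment> \<open>An empty cover would mean an empty space, where the minimal subcover has
    cardinality 0, below any exponential.\<close>
  have "\<U> \<noteq> {}"
  proof
    assume "\<U> = {}"
    obtain s where s: "s \<in> carrier G" by blast
    have empty: "topspace mtopology = {}"
      unfolding topspace_mtopology using covU \<open>\<U> = {}\<close> by simp
    have "min_subcover_card mtopology (cover_power mtopology \<phi> {s} \<U>) \<le> card ({} :: 'c set set)"
      by (rule min_subcover_card_le) (simp_all only: empty, simp_all)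
    then show False using big[of "{s}"] s by (simp add: not_le)
  qed
  then have k: "card \<U> > 0" using finU by (simp add: card_gt_0_iff)
  \<comment> \<open>There are \<open>card F * card \<U>\<close> coordinates, so the rate per
    coordinate is \<open>c / card \<U>\<close>.\<close>
  have "c / card \<U> > 0" using k \<open>c > 0\<close> by simp
  from shattered_of_large_cover[OF this, where 'z="'a \<times> 'c set" and 'x='c] obtain q :: real where "q > 0" and
    q: "\<And>(Z::('a \<times> 'c set) set) (P::'a \<times> 'c set \<Rightarrow> bool \<Rightarrow> 'c set) S. finite Z \<Longrightarrow> Z \<noteq> {} \<Longrightarrow>
           (\<forall>z\<in>Z. P z False \<inter> P z True = {}) \<Longrightarrow>
           (\<And>T. finite T \<Longrightarrow> (\<forall>x\<in>S. \<exists>t\<in>T. \<forall>z\<in>Z. x \<notin> P z (\<not> t z)) \<Longrightarrow> exp (c / card \<U> * card Z) \<le> card T) \<Longrightarrow>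
           \<exists>J\<in>shattered Z P S. q * card Z \<le> card J" by blast
  define \<A> :: "('a \<times> (bool list \<Rightarrow> 'c set)) set" where "\<A> = (\<lambda>U. (\<one>, \<lambda>v. A U (hd v))) ` \<U>"
  have "\<exists>S\<subseteq>F. q * card F \<le> real (card S) \<and> independent (words 0) \<A> S"
    if F: "finite F" "F \<noteq> {}" "F \<subseteq> carrier G" for F
  proof -
    define P where "P z b = {x\<in>E. \<phi> (fst z) x \<in> A (snd z) b}" for z :: "'a \<times> 'c set" and b
    let ?Z = "F \<times> \<U>"
    have "\<exists>J\<in>shattered ?Z P E. q * card ?Z \<le> card J"
    proof (rule q)
      show "finite ?Z" "?Z \<noteq> {}" using F finU \<open>\<U> \<noteq> {}\<close> by auto
      show "\<forall>z\<in>?Z. P z False \<inter> P z True = {}"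
      proof (intro ballI equals0I)
        fix z x assume "z \<in> ?Z" "x \<in> P z False \<inter> P z True"
        then have "\<phi> (fst z) x \<in> A (snd z) False" "\<phi> (fst z) x \<in> A (snd z) True" by (simp_all add: P_def)
        moreover from this(1) have "\<phi> (fst z) x \<in> E" by (simp add: A_def)
        ultimately have "\<phi> (fst z) x \<in> E" "\<epsilon> \<le> d (\<phi> (fst z) x) (\<phi> (fst z) x)" using sepA by blast+
        then show False using \<open>\<epsilon> > 0\<close> by simp
      qed
      fix T :: "('a \<times> 'c set \<Rightarrow> bool) set"
      assume T: "finite T" "\<forall>x\<in>E. \<exists>t\<in>T. \<forall>z\<in>?Z. x \<notin> P z (\<not> t z)"
      \<comment> \<open>\<open>g t s\<close> is a set marked by \<open>t\<close> at
        \<open>s\<close>. If \<open>x\<close> never contradicts \<open>t\<close>, then by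
        \<open>covA\<close> some set is marked at every \<open>s\<close>, and any marked set
        contains \<open>\<phi> s x\<close>; the second choice is a default for other
        patterns.\<close>
      define g where "g t s = (if \<exists>U\<in>\<U>. t (s, U) then SOME U. U \<in> \<U> \<and> t (s, U) else SOME U. U \<in> \<U>)"
        for t :: "'a \<times> 'c set \<Rightarrow> bool" and s
      have g1: "g t s \<in> \<U> \<and> t (s, g t s)" if "\<exists>U\<in>\<U>. t (s, U)" for t s
      proof -
        from that have "\<exists>U. U \<in> \<U> \<and> t (s, U)" by blast
        from someI_ex[OF this] show ?thesis unfolding g_def using that by simp
      qed
      have g2: "g t s \<in> \<U>" for t s
      proof (cases "\<exists>U\<in>\<U>. t (s, U)")
        case True
        then show ?thesis using g1 by blast
      next
        case False
        then show ?thesis using \<open>\<U> \<noteq> {}\<close> by (simp add: g_def some_in_eq)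
      qed
      define V where "V t = (\<Inter>s\<in>F. {x\<in>E. \<phi> s x \<in> g t s})" for t
      have "V t \<in> cover_power mtopology \<phi> F \<U>" for t
        unfolding cover_power_def Cover_join_def V_def translate_cover_def topspace_mtopology
        by (intro CollectI exI[of _ "\<lambda>s. {x\<in>E. \<phi> s x \<in> g t s}"] conjI refl ballI imageI g2)
      moreover have "\<Union>(V ` T) = E"
      proof
        show "\<Union>(V ` T) \<subseteq> E" using F(2) by (auto simp: V_def)
        show "E \<subseteq> \<Union>(V ` T)"
        proof
          fix x assume x: "x \<in> E"
          then obtain t where "t \<in> T" "\<forall>z\<in>?Z. x \<notin> P z (\<not> t z)" using T(2) by blast
          then have t: "t \<in> T" "\<And>s U. s \<in> F \<Longrightarrow> U \<in> \<U> \<Longrightarrow> x \<notin> P (s, U) (\<not> t (s, U))"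
            by simp_all
          have "\<phi> s x \<in> g t s" if s: "s \<in> F" for s
          proof -
            have sx: "\<phi> s x \<in> E" using s F(3) x by (auto intro: action_closed)
            from covA[OF this] obtain U where "U \<in> \<U>" "\<phi> s x \<in> A U True" by blast
            then have "t (s, U)" using t(2)[OF s, of U] x sx by (cases "t (s, U)") (simp_all add: P_def)
            then have "g t s \<in> \<U>" "t (s, g t s)" using g1[of t s] \<open>U \<in> \<U>\<close> by auto
            then show ?thesis using t(2)[OF s, of "g t s"] x sx by (simp add: P_def A_def)
          qed
          then show "x \<in> \<Union>(V ` T)" using t(1) x by (auto simp: V_def)
        qed
      qed
      ultimately have "min_subcover_card mtopology (cover_power mtopology \<phi> F \<U>) \<le> card (V ` T)"
        using T(1) by (intro min_subcover_card_le) auto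
      also have "\<dots> \<le> card T" using T(1) by (rule card_image_le)
      finally have "exp (c * card F) \<le> card T" using big[OF F] by linarith
      then show "exp (c / card \<U> * card ?Z) \<le> card T" using k by (simp add: card_cartesian_product)
    qed
    then obtain J where J: "J \<in> shattered ?Z P E" "q * card ?Z \<le> card J" by blast
    then have JZ: "J \<subseteq> ?Z" by (simp add: shattered_def)
    let ?S = "fst ` J"
    have "J \<subseteq> ?S \<times> \<U>" using JZ by force
    moreover have "finite ?S" using JZ F(1) finU by (meson finite_SigmaI finite_imageI finite_subset)
    ultimately have "card J \<le> card (?S \<times> \<U>)" using finU by (intro card_mono) auto
    then have "real (card J) \<le> real (card ?S) * card \<U>"
      by (simp add: card_cartesian_product flip: of_nat_mult)
    with J(2) have "(q * card F) * card \<U> \<le> real (card ?S) * card \<U>"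
      by (simp add: card_cartesian_product mult_ac)
    then have "q * card F \<le> real (card ?S)" using k by simp
    moreover have "independent (words 0) \<A> ?S"
    proof -
      have "\<forall>s\<in>?S. \<exists>U. (s, U) \<in> J" by force
      from bchoice[OF this] obtain c where c: "\<forall>s\<in>?S. (s, c s) \<in> J" ..
      show ?thesis unfolding independent_def
      proof (intro exI[of _ "\<lambda>s. (\<one>, \<lambda>v. A (c s) (hd v))"] conjI ballI allI impI)
        fix s assume "s \<in> ?S"
        then have "c s \<in> \<U>" using c JZ by blast
        then show "(\<one>, \<lambda>v. A (c s) (hd v)) \<in> \<A>" by (auto simp: \<A>_def)
      next
        fix \<omega> :: "'a \<Rightarrow> bool list"
        obtain x where x: "x \<in> E" "\<forall>z\<in>J. x \<in> P z (hd (\<omega> (fst z)))"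
          using J(1) unfolding shattered_def by fast
        show "\<exists>x\<in>E. \<forall>s\<in>?S. \<phi> (fst (\<one>, \<lambda>v. A (c s) (hd v)) \<otimes> s) x \<in> snd (\<one>, \<lambda>v. A (c s) (hd v)) (\<omega> s)"
        proof (intro bexI[OF _ x(1)] ballI)
          fix s assume s: "s \<in> ?S"
          then have "(s, c s) \<in> J" "s \<in> carrier G" using c JZ F(3) by auto
          then show "\<phi> (fst (\<one>, \<lambda>v. A (c s) (hd v)) \<otimes> s) x \<in> snd (\<one>, \<lambda>v. A (c s) (hd v)) (\<omega> s)"
            using x(2) by (auto simp: P_def)
        qed
      qed
    qed
    moreover have "?S \<subseteq> F" using JZ by auto
    ultimately show ?thesis by blast
  qed
  then have "positive_density (words 0) \<A>" unfolding positive_density_def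
    using \<open>q > 0\<close> by (intro exI[of _ q] conjI allI impI)
  then have "stage 0 \<epsilon> \<A>" unfolding stage_def
    using finU clA sepA by (auto simp: \<A>_def)
  then show ?thesis using \<open>\<epsilon> > 0\<close> that by blast
qed

end

text \<open>\<open>\<eta>\<close> is a Lebesgue number for \<open>d\<close> of the cover by
  \<open>d'\<close>-balls of radius \<open>e / 2\<close>. This transfers the scrambled set from one
  metric to every compatible one.\<close>

lemma metric_uniformly_equivalent:
  assumes "Metric_space M d" "Metric_space M d'"
    and "Metric_space.mtopology M d = Metric_space.mtopology M d'"
    and "compact_space (Metric_space.mtopology M d)" "e > 0"
  obtains \<eta> where "\<eta> > 0" "\<And>x y. x \<in> M \<Longrightarrow> y \<in> M \<Longrightarrow> d x y < \<eta> \<Longrightarrow> d' x y < e"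
proof -
  interpret A: Metric_space M d by fact
  interpret B: Metric_space M d' by fact
  have "compactin A.mtopology M" using assms(4) by (simp add: compact_space_def)
  moreover have "M \<subseteq> \<Union>((\<lambda>z. B.mball z (e/2)) ` M)" using assms(5) by auto
  ultimately have "\<exists>\<eta>>0. \<forall>x\<in>M. \<exists>U\<in>(\<lambda>z. B.mball z (e/2)) ` M. A.mball x \<eta> \<subseteq> U"
    by (rule A.lebesgue_number) (auto simp: assms(3))
  then obtain \<eta> where "\<eta> > 0"
    and \<eta>: "\<And>x. x \<in> M \<Longrightarrow> \<exists>U\<in>(\<lambda>z. B.mball z (e/2)) ` M. A.mball x \<eta> \<subseteq> U" by blast
  have "d' x y < e" if xy: "x \<in> M" "y \<in> M" "d x y < \<eta>" for x y
  proof -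
    from \<eta>[OF xy(1)] obtain z where z: "z \<in> M" "A.mball x \<eta> \<subseteq> B.mball z (e/2)" by auto
    have "x \<in> A.mball x \<eta>" "y \<in> A.mball x \<eta>" using xy \<open>\<eta> > 0\<close> by auto
    then have "x \<in> B.mball z (e/2)" "y \<in> B.mball z (e/2)" using z(2) by blast+
    then have "d' z x < e/2" "d' z y < e/2" by auto
    then show ?thesis using B.triangle[of x z y] B.commute[of x z] xy z(1) by simp
  qed
  then show ?thesis using \<open>\<eta> > 0\<close> that by blast
qed

section \<open>Uncountably many labels and the scrambled set\<close>

lemma uncountable_nat_to_bool: "uncountable (UNIV :: (nat \<Rightarrow> bool) set)"
proof
  assume "countable (UNIV :: (nat \<Rightarrow> bool) set)"
  then have "range (from_nat_into (UNIV :: (nat \<Rightarrow> bool) set)) = UNIV"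
    by (intro range_from_nat_into) auto
  then obtain f :: "nat \<Rightarrow> nat \<Rightarrow> bool" where "range f = UNIV" by blast
  then obtain n where "f n = (\<lambda>n. \<not> f n n)" by (metis UNIV_I image_iff)
  then show False by (metis (full_types))
qed

theorem theorem1p1:
  fixes G :: "('g, 'm) monoid_scheme"
    and X :: "'x topology"
    and \<phi> :: "'g \<Rightarrow> 'x \<Rightarrow> 'x"
  assumes "group G" and "countable (carrier G)" and "infinite (carrier G)"
    and "compact_space X" and "metrizable_space X"
    and "continuous_action G X \<phi>"
    and "naive_entropy G X \<phi> > 0"
  shows "li_yorke_chaotic G X \<phi>"
proof -
  obtain d where "Metric_space (topspace X) d" and X: "Metric_space.mtopology (topspace X) d = X"
    using assms(5) unfolding metrizable_space_def by (metis Metric_space.topspace_mtopology)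
  then interpret d: Metric_space "topspace X" d by blast
  have "group_action G (topspace X) \<phi>" using assms(6) by (simp add: continuous_action_def)
  then interpret group_action G "topspace X" \<phi> .
  interpret compact_metric_action G "topspace X" \<phi> d
    by unfold_locales (use assms(3,4,6) X in \<open>auto simp: continuous_action_def\<close>)
  obtain \<U> where U: "finite_open_cover X \<U>" "naive_entropy_cover G X \<phi> \<U> > 0"
    using assms(7) unfolding naive_entropy_def less_SUP_iff by blast
  \<comment> \<open>The entropy of a cover is an infimum, so \<open>c\<close> is a rate valid for
    all finite \<open>F\<close> at once.\<close>
  then obtain c where c: "0 < ereal c" "ereal c < naive_entropy_cover G X \<phi> \<U>"
    using ereal_dense2 by blast
  have big: "exp (c * card F) \<le> min_subcover_card X (cover_power X \<phi> F \<U>)"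
    if F: "finite F" "F \<noteq> {}" "F \<subseteq> carrier G" for F
  proof -
    let ?N = "real (min_subcover_card X (cover_power X \<phi> F \<U>))"
    have "naive_entropy_cover G X \<phi> \<U> \<le> ereal (ln ?N / card F)"
      unfolding naive_entropy_cover_def by (rule INF_lower) (use F in auto)
    then have "ereal c < ereal (ln ?N / card F)" using c(2) by (rule less_le_trans[rotated])
    then have "c < ln ?N / card F" by simp
    moreover have "card F > 0" using F by (simp add: card_gt_0_iff)
    ultimately have *: "c * card F < ln ?N" by (simp add: field_simps)
    moreover have "0 < c * card F" using c(1) \<open>card F > 0\<close> by simp
    \<comment> \<open>If \<open>?N = 0\<close>, the convention \<open>ln 0 = 0\<close> would
      contradict \<open>0 < c * card F\<close>.\<close>
    ultimately have "?N > 0" by (cases "?N = 0") auto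
    then show ?thesis using * by (metis exp_le_cancel_iff exp_ln less_imp_le)
  qed
  have "finite_open_cover d.mtopology \<U>" "0 < c" using U c X by simp_all
  from stage_zero[OF this] big obtain \<delta> \<A> where "\<delta> > 0" and st: "stage 0 \<delta> \<A>"
    unfolding X by blast
  \<comment> \<open>An exhaustion of the countable group by finite sets: times outside
    \<open>K n\<close> tend to infinity.\<close>
  define K where "K n = from_nat_into (carrier G) ` {..<n}" for n
  have finite_K: "finite (K n)" for n by (simp add: K_def)
  have K: "\<exists>N. \<forall>n\<ge>N. F \<subseteq> K n" if F: "finite F" "F \<subseteq> carrier G" for F
  proof (intro exI allI impI subsetI)
    fix n s assume n: "n \<ge> Suc (Max (to_nat_on (carrier G) ` F))" and s: "s \<in> F"
    then have "to_nat_on (carrier G) s \<le> Max (to_nat_on (carrier G) ` F)" using F(1) by simp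
    then show "s \<in> K n" using n s F(2) assms(2) unfolding K_def
      by (intro image_eqI[of _ _ "to_nat_on (carrier G) s"]) auto
  qed
  from scrambled_points[of \<delta> \<A> K, OF st finite_K] obtain x :: "(nat \<Rightarrow> bool) \<Rightarrow> 'x"
    where x: "\<forall>\<omega>. x \<omega> \<in> topspace X"
    and prox: "\<forall>n. \<exists>t\<in>carrier G - K n. \<forall>\<omega> \<omega>'. d (\<phi> t (x \<omega>)) (\<phi> t (x \<omega>')) < inverse (Suc n)"
    and sep: "\<forall>n. \<exists>s\<in>carrier G - K n. \<forall>\<omega> \<omega>'. \<omega> (Suc n) \<noteq> \<omega>' (Suc n) \<longrightarrow> \<delta> \<le> d (\<phi> s (x \<omega>)) (\<phi> s (x \<omega>'))"
    by (elim exE conjE)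
  \<comment> \<open>Each bit \<open>a i\<close> is repeated at all places
    \<open>Suc (prod_encode (i, N))\<close>, so different \<open>a\<close> give branches that differ
    infinitely often. The shift by 1 matches the letter \<open>\<omega> (Suc n)\<close> seen at step
    \<open>n\<close>.\<close>
  define y where "y a = x (\<lambda>n. a (fst (prod_decode (n - 1))))" for a :: "nat \<Rightarrow> bool"
  have y: "y a \<in> topspace X" for a using x by (simp add: y_def)
  have often_sep: "\<exists>s\<in>carrier G - F. \<delta> \<le> d (\<phi> s (y a)) (\<phi> s (y b))" 
    if "a \<noteq> b" and F: "finite F" "F \<subseteq> carrier G" for a b F
  proof -
    from \<open>a \<noteq> b\<close> obtain i where i: "a i \<noteq> b i" by blast
    from K[OF F] obtain N where N: "\<forall>n\<ge>N. F \<subseteq> K n" by blast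
    have "F \<subseteq> K (prod_encode (i, N))" using N le_prod_encode_2 by blast
    moreover obtain s where "s \<in> carrier G - K (prod_encode (i, N))"
      "\<forall>\<omega> \<omega>'. \<omega> (Suc (prod_encode (i, N))) \<noteq> \<omega>' (Suc (prod_encode (i, N))) \<longrightarrow> \<delta> \<le> d (\<phi> s (x \<omega>)) (\<phi> s (x \<omega>'))"
      using sep by blast
    ultimately show ?thesis using i by (intro bexI[of _ s]) (auto simp: y_def)
  qed
  have often_prox: "\<exists>s\<in>carrier G - F. d (\<phi> s (y a)) (\<phi> s (y b)) < \<eta>"
    if "\<eta> > 0" and F: "finite F" "F \<subseteq> carrier G" for a b F \<eta>
  proof -
    from K[OF F] obtain N where N: "\<forall>n\<ge>N. F \<subseteq> K n" by blast
    from reals_Archimedean[OF \<open>\<eta> > 0\<close>] obtain M where M: "inverse (real (Suc M)) < \<eta>" by blast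
    have "inverse (real (Suc (max M N))) \<le> inverse (real (Suc M))" by (intro le_imp_inverse_le) auto
    then have "inverse (real (Suc (max M N))) < \<eta>" using M by (rule le_less_trans)
    moreover have "F \<subseteq> K (max M N)" using N by simp
    moreover obtain s where "s \<in> carrier G - K (max M N)"
      "\<forall>\<omega> \<omega>'. d (\<phi> s (x \<omega>)) (\<phi> s (x \<omega>')) < inverse (Suc (max M N))"
      using prox by blast
    ultimately show ?thesis unfolding y_def by (intro bexI[of _ s]) (blast intro: less_trans)+
  qed
  have "inj y"
  proof (rule injI, rule ccontr)
    fix a b assume "y a = y b" "a \<noteq> b"
    from often_sep[OF this(2), of "{}"] obtain s where "s \<in> carrier G" "\<delta> \<le> d (\<phi> s (y a)) (\<phi> s (y b))" by auto
    moreover have "\<phi> s (y b) \<in> topspace X" using \<open>s \<in> carrier G\<close> y by (rule action_closed)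
    ultimately show False using \<open>\<delta> > 0\<close> \<open>y a = y b\<close> by simp
  qed
  then have unc: "uncountable (range y)"
    using uncountable_nat_to_bool countable_image_inj_eq by blast
  have LY: "Limsup (at_infinity_in G) (\<lambda>s. ereal (\<rho> (\<phi> s (y a)) (\<phi> s (y b)))) > 0 \<and>
             Liminf (at_infinity_in G) (\<lambda>s. ereal (\<rho> (\<phi> s (y a)) (\<phi> s (y b)))) = 0"
    if \<rho>: "compatible_metric X \<rho>" and "a \<noteq> b" for \<rho> a b
  proof -
    have m\<rho>: "Metric_space (topspace X) \<rho>" "Metric_space.mtopology (topspace X) \<rho> = X"
      using \<rho> by (auto simp: compatible_metric_def)
    let ?f = "\<lambda>s. ereal (\<rho> (\<phi> s (y a)) (\<phi> s (y b)))"
    \<comment> \<open>Read contrapositively: distance at least \<open>\<delta>\<close> in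
      \<open>d\<close> forces distance at least \<open>\<eta>\<close> in \<open>\<rho>\<close>,
      which bounds the upper limit from below.\<close>
    obtain \<eta> where "\<eta> > 0" and \<eta>: "\<And>x y. x \<in> topspace X \<Longrightarrow> y \<in> topspace X \<Longrightarrow> \<rho> x y < \<eta> \<Longrightarrow> d x y < \<delta>"
      by (rule metric_uniformly_equivalent[OF m\<rho>(1) d.Metric_space_axioms, of \<delta>])
        (use X m\<rho>(2) assms(4) \<open>\<delta> > 0\<close> in auto)
    have "\<not> Limsup (at_infinity_in G) ?f < ereal \<eta>"
    proof
      assume "Limsup (at_infinity_in G) ?f < ereal \<eta>"
      from Limsup_lessD[OF this] obtain F where F: "finite F" "F \<subseteq> carrier G" "\<forall>s\<in>carrier G - F. ?f s < ereal \<eta>"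
        unfolding eventually_at_infinity_in by blast
      from often_sep[OF \<open>a \<noteq> b\<close> F(1,2)] obtain s where s: "s \<in> carrier G - F" "\<delta> \<le> d (\<phi> s (y a)) (\<phi> s (y b))" by blast
      then have "\<phi> s (y a) \<in> topspace X" "\<phi> s (y b) \<in> topspace X" using y by (auto intro: action_closed)
      moreover have "\<rho> (\<phi> s (y a)) (\<phi> s (y b)) < \<eta>" using F(3) s(1) by simp
      ultimately show False using \<eta> s(2) by fastforce
    qed
    then have 1: "Limsup (at_infinity_in G) ?f > 0"
      using \<open>\<eta> > 0\<close> by (metis ereal_less(2) less_le_trans not_less)
    have "\<not> Liminf (at_infinity_in G) ?f > 0"
    proof
      assume "Liminf (at_infinity_in G) ?f > 0"
      then obtain e where e: "0 < ereal e" "ereal e < Liminf (at_infinity_in G) ?f" using ereal_dense2 by blast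
      from less_LiminfD[OF e(2)] obtain F where F: "finite F" "F \<subseteq> carrier G" "\<forall>s\<in>carrier G - F. ereal e < ?f s"
        unfolding eventually_at_infinity_in by blast
      obtain \<kappa> where "\<kappa> > 0" and \<kappa>: "\<And>x y. x \<in> topspace X \<Longrightarrow> y \<in> topspace X \<Longrightarrow> d x y < \<kappa> \<Longrightarrow> \<rho> x y < e"
        by (rule metric_uniformly_equivalent[OF d.Metric_space_axioms m\<rho>(1), of e])
          (use X m\<rho>(2) assms(4) e(1) in auto)
      from often_prox[OF \<open>\<kappa> > 0\<close> F(1,2), of a b] obtain s where
        s: "s \<in> carrier G - F" "d (\<phi> s (y a)) (\<phi> s (y b)) < \<kappa>" by blast
      then have "\<phi> s (y a) \<in> topspace X" "\<phi> s (y b) \<in> topspace X" using y by (auto intro: action_closed)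
      then have "\<rho> (\<phi> s (y a)) (\<phi> s (y b)) < e" using \<kappa> s(2) by blast
      then show False using F(3)[rule_format, OF s(1)] by simp
    qed
    moreover have "0 \<le> Liminf (at_infinity_in G) ?f"
      by (rule Liminf_bounded) (simp add: Metric_space.nonneg[OF m\<rho>(1)])
    ultimately show ?thesis using 1 by (simp add: order_antisym not_less)
  qed
  show ?thesis unfolding li_yorke_chaotic_def
  proof (intro exI[of _ "range y"] conjI[OF _ conjI] allI impI ballI)
    show "range y \<subseteq> topspace X" using y by auto
    show "uncountable (range y)" by (rule unc)
    fix \<rho> p q assume \<rho>: "compatible_metric X \<rho>" and "p \<in> range y" "q \<in> range y" "p \<noteq> q"
    then obtain a b where "p = y a" "q = y b" "a \<noteq> b" by auto
    then show "0 < Limsup (at_infinity_in G) (\<lambda>s. ereal (\<rho> (\<phi> s p) (\<phi> s q))) \<and>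
        Liminf (at_infinity_in G) (\<lambda>s. ereal (\<rho> (\<phi> s p) (\<phi> s q))) = 0"
      using LY[OF \<rho>] by simp
  qed
qed

end
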